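(* Let $k$ be a finite field of odd characteristic, let $\Pi$ be an irreducible cuspidal representation of $\mathrm{G}_2(k)$ and let $\chi$ be a character of $k^\times$. Then $$\dim\mathrm{Hom}_J(\Pi,I(\chi)\otimes \omega_\psi)\le 1.$$
   Context: All representations are complex and finite dimensional. $k$ is a finite field of odd characteristic, $\psi$ a fixed nontrivial additive character of $k$, $\epsilon$ the quadratic character of $k^\times$, $\mathcal{S}(k)$ the space of functions $k\to\mathbb{C}$. $E_{ij}$ are the $7\times 7$ matrix units, $I=I_7$. For $r\in k$ put $\mathbf{x}_\alpha(r)=I-2rE_{24}-r^2E_{26}+rE_{46}-rE_{51}-rE_{73}$, $\mathbf{x}_{-\alpha}(r)=I-rE_{15}-rE_{37}-rE_{42}-r^2E_{62}+2rE_{64}$, $\mathbf{x}_\beta(r)=I+rE_{12}-rE_{67}$, $\mathbf{x}_{-\beta}(r)={}^t\mathbf{x}_\beta(r)$, $\mathbf{x}_{\alpha+\beta}(r)=I-2rE_{14}-r^2E_{17}+rE_{47}+rE_{52}+rE_{63}$, $\mathbf{x}_{2\alpha+\beta}(r)=I-rE_{16}+rE_{27}-rE_{43}+r^2E_{53}-2rE_{54}$, $\mathbf{x}_{3\alpha+\beta}(r)=I+rE_{23}+rE_{56}$, $\mathbf{x}_{3\alpha+2\beta}(r)=I+rE_{13}+rE_{57}$. $\mathrm{G}_2(k)\subset \mathrm{GL}_7(k)$ is the group generated by all $\mathbf{x}_{\pm\alpha}(r),\mathbf{x}_{\pm\beta}(r)$; it is the split group of type $\mathrm{G}_2$ with short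 simple root $\alpha$ and long simple root $\beta$. Let $U_\gamma=\{\mathbf{x}_\gamma(r):r\in k\}$ and $h(a,b)=\mathrm{diag}(a,b,(ab)^{-1},1,ab,b^{-1},a^{-1})$. For $m\in\mathrm{GL}_2(k)$ put $m^*=\begin{pmatrix}0&1\\1&0\end{pmatrix}{}^tm^{-1}\begin{pmatrix}0&1\\1&0\end{pmatrix}$. Let $M=\{\mathrm{diag}(m,\det(m)^{-1},1,\det(m),m^* )\}\cong\mathrm{GL}_2(k)$ (containing $U_\beta$), let $V$ be generated by $U_\alpha,U_{\alpha+\beta},U_{2\alpha+\beta},U_{3\alpha+\beta},U_{3\alpha+2\beta}$, $P=MV$ (a maximal parabolic subgroup), and $J=\mathrm{SL}_2(k)\ltimes V\subset P$ with $\mathrm{SL}_2(k)\subset\mathrm{GL}_2(k)\cong M$. $\omega_\psi$ is the Weil representation of $J$ on $\mathcal{S}(k)$, the unique representation with $\omega_\psi(\mathbf{x}_\alpha(r_1)\mathbf{x}_{2\alpha+\beta}(r_3)\mathbf{x}_{3\alpha+\beta}(r_4)\mathbf{x}_{3\alpha+2\beta}(r_5))\phi(\xi)=\psi(r_3)\phi(\xi+r_1)$, $\omega_\psi(\mathbf{x}_{\alpha+\beta}(r_2))\phi(\xi)=\psi(-2\xi r_2)\phi(\xi)$, $\omega_\psi(h(a,a^{-1}))\phi(\xi)=\epsilon(a)\phi(a\xi)$, $\omega_\psi(\mathbf{x}_\beta(b))\phi(\xi)=\psi(b\xi^2)\phi(\xi)$. $I(\chi)$ is the space of $f:\mathrm{SL}_2(k)\to\mathbb{C}$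 with $f\left(\begin{pmatrix}a&b\\0&a^{-1}\end{pmatrix}g\right)=\chi(a)f(g)$, with $\mathrm{SL}_2(k)$ acting by right translation; it is a representation of $J$ via the quotient $J\to J/V=\mathrm{SL}_2(k)$. *)

theory Defs
  imports
    "HOL-Analysis.Analysis"
    "HOL-Algebra.Generated_Groups"
    "HOL-Library.Function_Algebras"
begin

section \<open>The group \<open>G\<^sub>2(k)\<close> and its subgroups\<close>

text \<open>In the index type \<^typ>\<open>7\<close> the numeral \<open>7\<close> denotes the same element as \<open>0\<close> (and \<open>2 = 0\<close> in
  \<^typ>\<open>2\<close>), so the numerals \<open>1, \<dots>, 7\<close> enumerate the rows and columns.\<close>

definition GL :: "('a::field^'n^'n) monoid" where
  "GL = \<lparr>carrier = {A. invertible A}, mult = (**), one = mat 1\<rparr>"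

definition E :: "7 \<Rightarrow> 7 \<Rightarrow> 'k::field \<Rightarrow> 'k^7^7" where
  "E i j c = (\<chi> a b. if a = i \<and> b = j then c else 0)"

definition x_a :: "'k::field \<Rightarrow> 'k^7^7" where
  "x_a r = mat 1 - E 2 4 (2 * r) - E 2 6 (r^2) + E 4 6 r - E 5 1 r - E 7 3 r"

definition x_ma :: "'k::field \<Rightarrow> 'k^7^7" where
  "x_ma r = mat 1 - E 1 5 r - E 3 7 r - E 4 2 r - E 6 2 (r^2) + E 6 4 (2 * r)"

definition x_b :: "'k::field \<Rightarrow> 'k^7^7" where
  "x_b r = mat 1 + E 1 2 r - E 6 7 r"

definition x_mb :: "'k::field \<Rightarrow> 'k^7^7" where
  "x_mb r = transpose (x_b r)"

definition x_ab :: "'k::field \<Rightarrow> 'k^7^7" where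
  "x_ab r = mat 1 - E 1 4 (2 * r) - E 1 7 (r^2) + E 4 7 r + E 5 2 r + E 6 3 r"

definition x_2ab :: "'k::field \<Rightarrow> 'k^7^7" where
  "x_2ab r = mat 1 - E 1 6 r + E 2 7 r - E 4 3 r + E 5 3 (r^2) - E 5 4 (2 * r)"

definition x_3ab :: "'k::field \<Rightarrow> 'k^7^7" where
  "x_3ab r = mat 1 + E 2 3 r + E 5 6 r"

definition x_3a2b :: "'k::field \<Rightarrow> 'k^7^7" where
  "x_3a2b r = mat 1 + E 1 3 r + E 5 7 r"

definition G2 :: "('k::field^7^7) set" where
  "G2 = generate GL (range x_a \<union> range x_ma \<union> range x_b \<union> range x_mb)"

definition h_torus :: "'k::field \<Rightarrow> 'k \<Rightarrow> 'k^7^7" where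
  "h_torus a b = E 1 1 a + E 2 2 b + E 3 3 (inverse (a * b)) + E 4 4 1 + E 5 5 (a * b)
     + E 6 6 (inverse b) + E 7 7 (inverse a)"

definition dual2 :: "'k::field^2^2 \<Rightarrow> 'k^2^2" where
  "dual2 m = vector [vector [0, 1], vector [1, 0]] ** transpose (matrix_inv m)
     ** vector [vector [0, 1], vector [1, 0]]"

text \<open>The block matrix \<open>diag(m, det(m)\<^sup>-\<^sup>1, 1, det(m), m\<^sup>*)\<close>.\<close>

definition levi :: "'k::field^2^2 \<Rightarrow> 'k^7^7" where
  "levi m = E 1 1 (m$1$1) + E 1 2 (m$1$2) + E 2 1 (m$2$1) + E 2 2 (m$2$2)
     + E 3 3 (inverse (det m)) + E 4 4 1 + E 5 5 (det m)
     + E 6 6 (dual2 m$1$1) + E 6 7 (dual2 m$1$2) + E 7 6 (dual2 m$2$1) + E 7 7 (dual2 m$2$2)"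

definition V_rad :: "('k::field^7^7) set" where
  "V_rad = generate GL (range x_a \<union> range x_ab \<union> range x_2ab \<union> range x_3ab \<union> range x_3a2b)"

definition SL2 :: "('k::field^2^2) set" where
  "SL2 = {m. det m = 1}"

definition J_grp :: "('k::field^7^7) set" where
  "J_grp = {levi m ** v | m v. m \<in> SL2 \<and> v \<in> V_rad}"

text \<open>The quotient map \<open>J \<rightarrow> J/V = SL\<^sub>2(k)\<close>; see \<open>J_to_SL2_levi\<close> below.\<close>

definition J_to_SL2 :: "'k::field^7^7 \<Rightarrow> 'k^2^2" where
  "J_to_SL2 j = (THE m. m \<in> SL2 \<and> (\<exists>v\<in>V_rad. j = levi m ** v))"

text \<open>Up to conjugacy the proper parabolic subgroups are \<open>P\<close>, the maximal parabolic subgroup whose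
  Levi factor contains \<open>U\<^sub>\<alpha>\<close>, and the Borel subgroup. Their unipotent radicals are
  generated by the positive root subgroups lying outside the Levi factor.\<close>

definition V'_rad :: "('k::field^7^7) set" where
  "V'_rad = generate GL (range x_b \<union> range x_ab \<union> range x_2ab \<union> range x_3ab \<union> range x_3a2b)"

definition U_borel :: "('k::field^7^7) set" where
  "U_borel = generate GL
     (range x_a \<union> range x_b \<union> range x_ab \<union> range x_2ab \<union> range x_3ab \<union> range x_3a2b)"

definition unipotent_radicals :: "('k::field^7^7) set set" where
  "unipotent_radicals =
     {(\<lambda>u. g ** u ** matrix_inv g) ` N | g N. g \<in> G2 \<and> N \<in> {V_rad, V'_rad, U_borel}}"


section \<open>Representations of matrix groups\<close>

text \<open>A complex vector space is a type together with a scalar multiplication \<open>s\<close>.\<close>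

definition is_representation ::
    "(complex \<Rightarrow> 'v::ab_group_add \<Rightarrow> 'v) \<Rightarrow> ('k::field^'n^'n) set \<Rightarrow> ('k^'n^'n \<Rightarrow> 'v \<Rightarrow> 'v) \<Rightarrow> bool" where
  "is_representation s H \<rho> \<longleftrightarrow>
     (\<exists>B. finite_dimensional_vector_space s B) \<and>
     (\<forall>g\<in>H. Vector_Spaces.linear s s (\<rho> g)) \<and>
     \<rho> (mat 1) = id \<and>
     (\<forall>g\<in>H. \<forall>h\<in>H. \<rho> (g ** h) = \<rho> g \<circ> \<rho> h)"

definition irreducible_rep ::
    "(complex \<Rightarrow> 'v::ab_group_add \<Rightarrow> 'v) \<Rightarrow> ('k::field^'n^'n) set \<Rightarrow> ('k^'n^'n \<Rightarrow> 'v \<Rightarrow> 'v) \<Rightarrow> bool" where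
  "irreducible_rep s H \<rho> \<longleftrightarrow>
     is_representation s H \<rho> \<and> (UNIV :: 'v set) \<noteq> {0} \<and>
     (\<forall>W. module.subspace s W \<and> (\<forall>g\<in>H. \<rho> g ` W \<subseteq> W) \<longrightarrow> W = {0} \<or> W = UNIV)"

definition cuspidal_G2 :: "('k::field^7^7 \<Rightarrow> 'v::ab_group_add \<Rightarrow> 'v) \<Rightarrow> bool" where
  "cuspidal_G2 \<rho> \<longleftrightarrow> (\<forall>N\<in>unipotent_radicals. {v. \<forall>u\<in>N. \<rho> u v = v} = {0})"

text \<open>\<open>Hom\<^sub>H\<close> into a subspace \<open>W\<close> of the second space, with \<open>H\<close> acting on \<open>W\<close> through \<open>\<sigma>\<close>.\<close>

definition Hom_rep ::
    "'g set \<Rightarrow> (complex \<Rightarrow> 'v::ab_group_add \<Rightarrow> 'v) \<Rightarrow> ('g \<Rightarrow> 'v \<Rightarrow> 'v) \<Rightarrow>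
     (complex \<Rightarrow> 'w::ab_group_add \<Rightarrow> 'w) \<Rightarrow> 'w set \<Rightarrow> ('g \<Rightarrow> 'w \<Rightarrow> 'w) \<Rightarrow> ('v \<Rightarrow> 'w) set" where
  "Hom_rep H s \<rho> t W \<sigma> =
     {T. Vector_Spaces.linear s t T \<and> range T \<subseteq> W \<and> (\<forall>g\<in>H. \<forall>v. T (\<rho> g v) = \<sigma> g (T v))}"

definition pointwise :: "(complex \<Rightarrow> 'w \<Rightarrow> 'w) \<Rightarrow> complex \<Rightarrow> ('x \<Rightarrow> 'w) \<Rightarrow> ('x \<Rightarrow> 'w)" where
  "pointwise s c f = (\<lambda>x. s c (f x))"

text \<open>For spaces of functions on finite sets \<open>X\<close> and \<open>Y\<close>, the tensor product is realised
  in the functions on \<open>X \<times> Y\<close>, with \<open>(f \<otimes> \<phi>)(x, y) = f x * \<phi> y\<close>.\<close>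

definition pure_tensor :: "('x \<Rightarrow> complex) \<Rightarrow> ('y \<Rightarrow> complex) \<Rightarrow> 'x \<times> 'y \<Rightarrow> complex" where
  "pure_tensor f \<phi> = (\<lambda>(x, y). f x * \<phi> y)"

definition tensor_space ::
    "('x \<Rightarrow> complex) set \<Rightarrow> ('y \<Rightarrow> complex) set \<Rightarrow> ('x \<times> 'y \<Rightarrow> complex) set" where
  "tensor_space A B = module.span (pointwise (*)) {pure_tensor f \<phi> | f \<phi>. f \<in> A \<and> \<phi> \<in> B}"

text \<open>\<open>S \<otimes> T\<close>: apply \<open>T\<close> in the second variable, then \<open>S\<close> in the first; see
  \<open>tensor_op_pure\<close> below.\<close>

definition tensor_op ::
    "(('x \<Rightarrow> complex) \<Rightarrow> ('x \<Rightarrow> complex)) \<Rightarrow> (('y \<Rightarrow> complex) \<Rightarrow> ('y \<Rightarrow> complex)) \<Rightarrow>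
     ('x \<times> 'y \<Rightarrow> complex) \<Rightarrow> ('x \<times> 'y \<Rightarrow> complex)" where
  "tensor_op S T F = (\<lambda>(x, y). S (\<lambda>x'. T (\<lambda>y'. F (x', y')) y) x)"


section \<open>Characters, \<open>I(\<chi>)\<close> and the Weil representation\<close>

definition nontrivial_additive_character :: "('k::field \<Rightarrow> complex) \<Rightarrow> bool" where
  "nontrivial_additive_character \<psi> \<longleftrightarrow>
     \<psi> 0 = 1 \<and> (\<forall>a b. \<psi> (a + b) = \<psi> a * \<psi> b) \<and> (\<exists>a. \<psi> a \<noteq> 1)"

text \<open>A character of \<open>k\<^sup>\<times>\<close> is a function on \<open>k\<close> whose value at \<open>0\<close> is irrelevant.\<close>

definition multiplicative_character :: "('k::field \<Rightarrow> complex) \<Rightarrow> bool" where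
  "multiplicative_character chi \<longleftrightarrow>
     chi 1 = 1 \<and> (\<forall>a b. a \<noteq> 0 \<longrightarrow> b \<noteq> 0 \<longrightarrow> chi (a * b) = chi a * chi b)"

definition quadratic_character :: "'k::field \<Rightarrow> complex" where
  "quadratic_character a = (if a = 0 then 0 else if \<exists>b. a = b^2 then 1 else -1)"

text \<open>Functions on \<open>SL\<^sub>2(k)\<close> are functions on all \<open>2 \<times> 2\<close> matrices vanishing outside \<open>SL\<^sub>2(k)\<close>.\<close>

definition I_chi :: "('k::field \<Rightarrow> complex) \<Rightarrow> ('k^2^2 \<Rightarrow> complex) set" where
  "I_chi chi = {f. (\<forall>g. g \<notin> SL2 \<longrightarrow> f g = 0) \<and>
     (\<forall>a b. \<forall>g\<in>SL2. a \<noteq> 0 \<longrightarrow>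
        f (vector [vector [a, b], vector [0, inverse a]] ** g) = chi a * f g)}"

definition right_translation ::
    "'k::field^2^2 \<Rightarrow> ('k^2^2 \<Rightarrow> complex) \<Rightarrow> ('k^2^2 \<Rightarrow> complex)" where
  "right_translation h f = (\<lambda>g. f (g ** h))"

text \<open>The stated formulas, together with being a representation of \<open>J\<close> on functions on \<open>k\<close>,
  determine the Weil representation on \<open>J\<close>; \<open>\<omega>\<close> is unconstrained outside \<open>J\<close>.\<close>

definition weil_representation ::
    "('k::field \<Rightarrow> complex) \<Rightarrow> ('k^7^7 \<Rightarrow> ('k \<Rightarrow> complex) \<Rightarrow> ('k \<Rightarrow> complex)) \<Rightarrow> bool" where
  "weil_representation \<psi> \<omega> \<longleftrightarrow>
     is_representation (pointwise (*)) J_grp \<omega> \<and>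
     (\<forall>r1 r3 r4 r5 \<phi> \<xi>.
        \<omega> (x_a r1 ** x_2ab r3 ** x_3ab r4 ** x_3a2b r5) \<phi> \<xi> = \<psi> r3 * \<phi> (\<xi> + r1)) \<and>
     (\<forall>r2 \<phi> \<xi>. \<omega> (x_ab r2) \<phi> \<xi> = \<psi> (- 2 * \<xi> * r2) * \<phi> \<xi>) \<and>
     (\<forall>a \<phi> \<xi>. a \<noteq> 0 \<longrightarrow> \<omega> (h_torus a (inverse a)) \<phi> \<xi> = quadratic_character a * \<phi> (a * \<xi>)) \<and>
     (\<forall>b \<phi> \<xi>. \<omega> (x_b b) \<phi> \<xi> = \<psi> (b * \<xi>^2) * \<phi> \<xi>)"

definition I_tensor_weil_space :: "('k::field \<Rightarrow> complex) \<Rightarrow> (('k^2^2) \<times> 'k \<Rightarrow> complex) set" where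
  "I_tensor_weil_space chi = tensor_space (I_chi chi) UNIV"

definition I_tensor_weil_action ::
    "('k::field^7^7 \<Rightarrow> ('k \<Rightarrow> complex) \<Rightarrow> ('k \<Rightarrow> complex)) \<Rightarrow>
     'k^7^7 \<Rightarrow> (('k^2^2) \<times> 'k \<Rightarrow> complex) \<Rightarrow> (('k^2^2) \<times> 'k \<Rightarrow> complex)" where
  "I_tensor_weil_action \<omega> j = tensor_op (right_translation (J_to_SL2 j)) (\<omega> j)"


section \<open>Consistency of the definitions\<close>

lemma vector_space_mult: "vector_space ((*) :: complex \<Rightarrow> complex \<Rightarrow> complex)"
  by unfold_locales (simp_all add: algebra_simps)

lemma vector_space_pointwise:
  assumes "vector_space s"
  shows "vector_space (pointwise s)"
proof -
  interpret vector_space s by fact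
  show ?thesis
    by unfold_locales (simp_all add: pointwise_def fun_eq_iff scale_right_distrib scale_left_distrib)
qed

lemma tensor_op_pure:
  assumes "Vector_Spaces.linear (pointwise (*)) (pointwise (*)) S"
    and "Vector_Spaces.linear (pointwise (*)) (pointwise (*)) T"
  shows "tensor_op S T (pure_tensor f \<phi>) = pure_tensor (S f) (T \<phi>)"
proof -
  have T: "T (\<lambda>y'. c * \<phi> y') = (\<lambda>y. c * T \<phi> y)" for c
    using module_hom.scale[of "pointwise (*)" "pointwise (*)" T c \<phi>] assms(2)
    by (simp add: pointwise_def Vector_Spaces.linear_def)
  have S: "S (\<lambda>x'. f x' * c) = (\<lambda>x. S f x * c)" for c
    using module_hom.scale[of "pointwise (*)" "pointwise (*)" S c f] assms(1)
    by (simp add: pointwise_def Vector_Spaces.linear_def mult.commute)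
  show ?thesis
    by (simp add: tensor_op_def pure_tensor_def T S)
qed

lemma exhaust_7: "x = 1 \<or> x = 2 \<or> x = 3 \<or> x = 4 \<or> x = 5 \<or> x = 6 \<or> x = 7" for x :: 7
proof (induct x)
  case (of_int z)
  then have "z = 0 \<or> z = 1 \<or> z = 2 \<or> z = 3 \<or> z = 4 \<or> z = 5 \<or> z = 6" by auto
  then show ?case by auto
qed

lemma forall_7: "(\<forall>i::7. P i) \<longleftrightarrow> P 1 \<and> P 2 \<and> P 3 \<and> P 4 \<and> P 5 \<and> P 6 \<and> P 7"
  by (metis exhaust_7)

lemma UNIV_7: "(UNIV :: 7 set) = {1, 2, 3, 4, 5, 6, 7}"
  using exhaust_7 by auto

lemma sum_7: "sum f (UNIV :: 7 set) = f 1 + f 2 + f 3 + f 4 + f 5 + f 6 + f 7"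
  unfolding UNIV_7 by (simp add: ac_simps)

text \<open>With respect to the flag \<open>5 > {1, 2} > 4 > {6, 7} > 3\<close> of blocks, \<open>V\<close> is block unitriangular.\<close>

definition flag_pos :: "7 \<Rightarrow> nat" where
  "flag_pos i = (if i = 5 then 0 else if i = 1 \<or> i = 2 then 1 else if i = 4 then 2
     else if i = 3 then 4 else 3)"

definition block_unitriangular :: "'k::field^7^7 \<Rightarrow> bool" where
  "block_unitriangular A \<longleftrightarrow>
     (\<forall>i j. flag_pos j \<le> flag_pos i \<longrightarrow> A$i$j = (if i = j then 1 else 0))"

lemma block_unitriangular_mult:
  assumes "block_unitriangular A" "block_unitriangular B"
  shows "block_unitriangular (A ** B)"
  using assms unfolding block_unitriangular_def forall_7
  by (simp add: flag_pos_def matrix_matrix_mult_def sum_7)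

lemma group_GL: "group (GL :: ('a::field^'n^'n) monoid)"
proof (rule groupI)
  fix A :: "'a^'n^'n"
  assume "A \<in> carrier GL"
  then obtain B where "A ** B = mat 1" "B ** A = mat 1"
    by (auto simp: GL_def invertible_def)
  then show "\<exists>B\<in>carrier GL. B \<otimes>\<^bsub>GL\<^esub> A = \<one>\<^bsub>GL\<^esub>"
    by (auto simp: GL_def invertible_def)
qed (auto simp: GL_def invertible_mult matrix_mul_assoc invertible_def[of "mat 1"])

lemma V_gen_unitriangular:
  "block_unitriangular (x_a r)" "block_unitriangular (x_ab r)" "block_unitriangular (x_2ab r)"
  "block_unitriangular (x_3ab r)" "block_unitriangular (x_3a2b r)"
  unfolding block_unitriangular_def forall_7
  by (simp_all add: flag_pos_def x_a_def x_ab_def x_2ab_def x_3ab_def x_3a2b_def E_def mat_def)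

lemma V_gen_mult_neg:
  "x_a (- r) ** x_a r = mat 1" "x_ab (- r) ** x_ab r = mat 1" "x_2ab (- r) ** x_2ab r = mat 1"
  "x_3ab (- r) ** x_3ab r = mat 1" "x_3a2b (- r) ** x_3a2b r = mat 1"
  unfolding vec_eq_iff forall_7
  by (simp_all add: x_a_def x_ab_def x_2ab_def x_3ab_def x_3a2b_def E_def mat_def
      matrix_matrix_mult_def sum_7 power2_eq_square)

lemma V_unitriangular:
  assumes "v \<in> V_rad"
  shows "block_unitriangular v"
  using assms unfolding V_rad_def
proof (induction rule: generate.induct)
  case one
  then show ?case by (simp add: GL_def block_unitriangular_def mat_def)
next
  case (incl h)
  then show ?case by (auto simp: V_gen_unitriangular)
next
  case (inv h)
  have *: "block_unitriangular (inv\<^bsub>GL\<^esub> (x r))"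
    if "\<And>r. x (- r) ** x r = mat 1" "\<And>r. block_unitriangular (x r)" for x :: "'a \<Rightarrow> 'a^7^7" and r
  proof -
    have "x r ** x (- r) = mat 1" using that(1)[of "- r"] by simp
    then have "inv\<^bsub>GL\<^esub> (x r) = x (- r)"
      using that(1) by (intro group.inv_equality[OF group_GL]) (auto simp: GL_def invertible_def)
    then show ?thesis using that(2) by simp
  qed
  note *[of x_a] *[of x_ab] *[of x_2ab] *[of x_3ab] *[of x_3a2b]
  with inv show ?case by (auto simp: V_gen_unitriangular V_gen_mult_neg)
next
  case (eng h1 h2)
  then show ?case by (simp add: GL_def block_unitriangular_mult)
qed

lemma J_to_SL2_levi:
  assumes "m \<in> SL2" "v \<in> V_rad"
  shows "J_to_SL2 (levi m ** v) = m"
proof -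
  have block: "(levi m' ** w)$1$1 = m'$1$1" "(levi m' ** w)$1$2 = m'$1$2"
      "(levi m' ** w)$2$1 = m'$2$1" "(levi m' ** w)$2$2 = m'$2$2"
    if "w \<in> V_rad" for m' :: "'a^2^2" and w
    using V_unitriangular[OF that] unfolding block_unitriangular_def forall_7
    by (simp_all add: flag_pos_def matrix_matrix_mult_def sum_7 levi_def E_def)
  have "m' = m" if "w \<in> V_rad" "levi m ** v = levi m' ** w" for m' w
    using block[OF assms(2), of m] block[OF that(1), of m'] that(2)
    by (simp add: vec_eq_iff forall_2)
  then show ?thesis
    unfolding J_to_SL2_def using assms by (intro the_equality) blast+
qed

text \<open>The library's \<open>dim\<close> is \<open>0\<close> for infinite-dimensional spaces; the \<open>Hom\<close>-spaces in question are
  finite-dimensional.\<close>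

lemma Hom_rep_finite_dimensional:
  fixes s :: "complex \<Rightarrow> 'v::ab_group_add \<Rightarrow> 'v"
    and t :: "complex \<Rightarrow> ('x::finite \<Rightarrow> complex) \<Rightarrow> ('x \<Rightarrow> complex)"
  assumes "is_representation s H' \<rho>" and t: "t = pointwise (*)"
  shows "\<exists>B. finite B \<and> Hom_rep H s \<rho> t W \<sigma> \<subseteq> module.span (pointwise t) B"
proof -
  obtain B where "finite_dimensional_vector_space s B"
    using assms by (auto simp: is_representation_def)
  then interpret fd: finite_dimensional_vector_space s B .
  interpret tv: vector_space t
    unfolding t by (rule vector_space_pointwise[OF vector_space_mult])
  interpret hv: vector_space "pointwise t"
    by (rule vector_space_pointwise) unfold_locales
  define e where "e = (\<lambda>(b, x). \<lambda>v (y::'x). if y = x then fd.representation B v b else 0)"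
  have "T \<in> hv.span (e ` (B \<times> UNIV))" if "T \<in> Hom_rep H s \<rho> t W \<sigma>" for T
  proof -
    have "Vector_Spaces.linear s t T" using that by (simp add: Hom_rep_def)
    then interpret T: Vector_Spaces.linear s t T .
    have "T v y = (\<Sum>p\<in>B \<times> UNIV. pointwise t (T (fst p) (snd p)) (e p)) v y" for v y
    proof -
      have sumfun: "(\<Sum>p\<in>A. F p) v y = (\<Sum>p\<in>A. F p v y)" if "finite A"
        for A and F :: "'v \<times> 'x \<Rightarrow> 'v \<Rightarrow> 'x \<Rightarrow> complex"
        using that by (induction A rule: finite_induct) simp_all
      have sumfun': "(\<Sum>p\<in>A. F p) y = (\<Sum>p\<in>A. F p y)" if "finite A"
        for A and F :: "'v \<Rightarrow> 'x \<Rightarrow> complex"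
        using that by (induction A rule: finite_induct) simp_all
      have "v = (\<Sum>b\<in>B. s (fd.representation B v b) b)"
        using fd.sum_representation_eq[OF fd.independent_Basis, of v B] fd.finite_Basis
        by (simp add: fd.span_Basis)
      then have "T v = T (\<Sum>b\<in>B. s (fd.representation B v b) b)" by simp
      also have "\<dots> = (\<Sum>b\<in>B. t (fd.representation B v b) (T b))"
        by (simp add: T.sum T.scale)
      finally have "T v y = (\<Sum>b\<in>B. fd.representation B v b * T b y)"
        by (simp add: sumfun' fd.finite_Basis t pointwise_def)
      also have "\<dots> = (\<Sum>b\<in>B. \<Sum>x\<in>UNIV. T b x * (if y = x then fd.representation B v b else 0))"
        by (simp add: if_distrib[of "(*) _"] mult.commute cong: if_cong)
      also have "\<dots> = (\<Sum>p\<in>B \<times> UNIV. pointwise t (T (fst p) (snd p)) (e p) v y)"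
        unfolding sum.cartesian_product by (simp add: e_def t pointwise_def case_prod_beta)
      finally show ?thesis
        by (simp add: sumfun fd.finite_Basis)
    qed
    then have "T = (\<Sum>p\<in>B \<times> UNIV. pointwise t (T (fst p) (snd p)) (e p))"
      by (intro ext)
    then show ?thesis
      by (metis (no_types, lifting) hv.span_sum hv.span_scale hv.span_base imageI)
  qed
  then show ?thesis
    by (intro exI[of _ "e ` (B \<times> UNIV)"]) (auto simp: fd.finite_Basis)
qed

end

theory Submission
  imports Defs "HOL-Computational_Algebra.Fundamental_Theorem_Algebra"
begin

text \<open>By Frobenius reciprocity, applied to \<open>I(\<chi>)\<close> and to the Schroedinger model of the Weil
  representation, a homomorphism is determined by a functional on \<open>\<Pi>\<close> on which the unipotent radical
  of the second maximal parabolic acts by the character \<open>\<psi>\<close> of \<open>U\<^bsub>2\<alpha>+\<beta>\<^esub>\<close> and a one-dimensional torus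
  acts by a fixed character. A Weyl group element moves \<open>2\<alpha>+\<beta>\<close> to \<open>\<alpha>\<close>; exchanging \<open>U\<^bsub>-\<beta>\<^esub>\<close> for
  \<open>U\<^bsub>\<alpha>+\<beta>\<^esub>\<close> turns the functional into one that transforms under \<open>V\<close> by \<open>\<psi>\<close> on \<open>U\<^bsub>\<alpha>\<^esub>\<close>. Expand it along
  \<open>U\<^bsub>\<beta>\<^esub>\<close>. The constant term vanishes since \<open>\<Pi>\<close> is cuspidal, and the torus permutes the other terms
  simply transitively, so the functional is determined by a single Whittaker functional. Whittaker
  functionals are unique up to scalars by the Gelfand--Kazhdan argument: the Hecke algebra of the
  generic character of the maximal unipotent subgroup is commutative, because an anti-automorphism
  fixes all its elements.\<close>


section \<open>Root subgroups and the Weyl group\<close>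

text \<open>The exchange of U_{-\<beta>} for U_{\<alpha>+\<beta>} loses no information: the
  commutator of elements with coordinates t and r has \<alpha>-coordinate -rt, and \<psi> turns this
  into a perfect pairing of the two groups; its other coordinates lie in root subgroups under which
  the functional is invariant. The torus elements \<open>h_torus c 1\<close> centralise U_\<alpha>
  and scale U_\<beta> by c. This is why they move the Fourier coefficient of frequency 1 to
  frequency c without disturbing the character on U_\<alpha>. That all homomorphisms give the same
  eigenvalue, quadratic character times \<chi>, makes one Whittaker coefficient enough. Uniqueness
  of Whittaker functionals is obtained on vectors: the projector onto the generic character has rank
  at most one, and a Whittaker functional is determined by its values on the range of that
  projector. The anti-automorphism is inversion followed by conjugation with a torus element on
  which both simple roots are -1. It works because -1 lies in the Weyl group and the Weyl elements
  that can support a Hecke operator are all involutions.\<close>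

definition vec7 :: "'k::field \<Rightarrow> 'k \<Rightarrow> 'k \<Rightarrow> 'k \<Rightarrow> 'k \<Rightarrow> 'k \<Rightarrow> 'k \<Rightarrow> 'k^7" where
  "vec7 a b c d e f g = (\<chi> i. if i = 1 then a else if i = 2 then b else if i = 3 then c
     else if i = 4 then d else if i = 5 then e else if i = 6 then f else g)"

lemma vec7_nth [simp]:
  "vec7 a b c d e f g $ 1 = a" "vec7 a b c d e f g $ 2 = b" "vec7 a b c d e f g $ 3 = c"
  "vec7 a b c d e f g $ 4 = d" "vec7 a b c d e f g $ 5 = e" "vec7 a b c d e f g $ 6 = f"
  "vec7 a b c d e f g $ 7 = g"
  by (simp_all add: vec7_def)

lemma vec7_eq_iff [simp]:
  "vec7 a b c d e f g = vec7 a' b' c' d' e' f' g' \<longleftrightarrow>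
     a = a' \<and> b = b' \<and> c = c' \<and> d = d' \<and> e = e' \<and> f = f' \<and> g = g'"
  unfolding vec_eq_iff forall_7 by simp

lemma vec7_eta: "v = vec7 (v$1) (v$2) (v$3) (v$4) (v$5) (v$6) (v$7)"
  unfolding vec_eq_iff forall_7 by simp

text \<open>Equations between products of sparse matrices are tested on a generic column vector, so
  that the factors are applied one after another by the rewrite rules for the actions and no sum
  over matrix entries is expanded.\<close>

lemma matrix_eq_vec7:
  assumes "\<And>a b c d e f g. A *v vec7 a b c d e f g = B *v vec7 a b c d e f g"
  shows "A = B"
  unfolding matrix_eq using assms vec7_eta by metis

lemma E_vec7 [simp]:
  "E i j r *v v = (\<chi> a. if a = i then r * v $ j else 0)"
  by (simp add: vec_eq_iff E_def matrix_vector_mult_def if_distrib[of "\<lambda>x. x * _"] cong: if_cong)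

lemma x_act:
  "x_a r *v vec7 a b c d e f g =
     vec7 a (b - 2 * r * d - r^2 * f) c (d + r * f) (e - r * a) f (g - r * c)"
  "x_ma r *v vec7 a b c d e f g =
     vec7 (a - r * e) b (c - r * g) (d - r * b) e (f - r^2 * b + 2 * r * d) g"
  "x_b r *v vec7 a b c d e f g = vec7 (a + r * b) b c d e (f - r * g) g"
  "x_ab r *v vec7 a b c d e f g =
     vec7 (a - 2 * r * d - r^2 * g) b c (d + r * g) (e + r * b) (f + r * c) g"
  "x_2ab r *v vec7 a b c d e f g =
     vec7 (a - r * f) (b + r * g) c (d - r * c) (e + r^2 * c - 2 * r * d) f g"
  "x_3ab r *v vec7 a b c d e f g = vec7 a (b + r * c) c d (e + r * f) f g"
  "x_3a2b r *v vec7 a b c d e f g = vec7 (a + r * c) b c d (e + r * g) f g"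
  unfolding x_a_def x_ma_def x_b_def x_ab_def x_2ab_def x_3ab_def x_3a2b_def vec_eq_iff forall_7
  by (simp_all add: matrix_vector_mult_add_rdistrib matrix_vector_mult_diff_rdistrib)

text \<open>The twelve root subgroups, in the order of the angles of the roots (in multiples of
  \<open>30\<close> degrees): \<open>0 = \<alpha>\<close>, \<open>1 = 3\<alpha>+\<beta>\<close>, \<open>2 = 2\<alpha>+\<beta>\<close>, \<open>3 = 3\<alpha>+2\<beta>\<close>, \<open>4 = \<alpha>+\<beta>\<close>, \<open>5 = \<beta>\<close>, and
  \<open>i + 6\<close> is the negative of \<open>i\<close>. The Weyl group then acts by the maps \<open>i \<mapsto> \<plusminus> i + m\<close>
  with \<open>m\<close> even.\<close>

definition root_elt :: "int \<Rightarrow> 'k::field \<Rightarrow> 'k^7^7" where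
  "root_elt i r =
     (if i mod 12 = 0 then x_a r else if i mod 12 = 1 then x_3ab r
      else if i mod 12 = 2 then x_2ab r else if i mod 12 = 3 then x_3a2b r
      else if i mod 12 = 4 then x_ab r else if i mod 12 = 5 then x_b r
      else if i mod 12 = 6 then x_ma r
      else if i mod 12 = 7 then mat 1 + E 3 2 r + E 6 5 r
      else if i mod 12 = 8 then mat 1 - E 6 1 r + E 7 2 r - E 3 4 (2 * r) + E 3 5 (r^2) - E 4 5 r
      else if i mod 12 = 9 then mat 1 + E 3 1 r + E 7 5 r
      else if i mod 12 = 10 then mat 1 - E 4 1 r - E 7 1 (r^2) + E 7 4 (2 * r) + E 2 5 r + E 3 6 r
      else x_mb r)"

lemma root_elt_mod: "root_elt (i mod 12) r = root_elt i r"
  by (simp add: root_elt_def)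

lemma root_elt_pos:
  "root_elt 0 r = x_a r" "root_elt 1 r = x_3ab r" "root_elt 2 r = x_2ab r"
  "root_elt 3 r = x_3a2b r" "root_elt 4 r = x_ab r" "root_elt 5 r = x_b r"
  "root_elt 6 r = x_ma r" "root_elt 11 r = x_mb r"
  by (simp_all add: root_elt_def)

lemma transpose_E: "transpose (E i j r) = E j i r"
  by (auto simp: transpose_def E_def vec_eq_iff)

lemma transpose_add: "transpose (A + B) = transpose A + transpose B"
  by (simp add: transpose_def vec_eq_iff)

lemma transpose_diff: "transpose (A - B) = transpose A - (transpose B :: 'a::ab_group_add^'n^'m)"
  by (simp add: transpose_def vec_eq_iff)

lemma x_mb_eq: "x_mb r = mat 1 + E 2 1 r - E 7 6 r"
  by (simp add: x_mb_def x_b_def transpose_E transpose_add transpose_diff)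

lemma root_elt_act [simp]:
  "root_elt 0 r *v vec7 a b c d e f g =
     vec7 a (b - 2 * r * d - r^2 * f) c (d + r * f) (e - r * a) f (g - r * c)"
  "root_elt 1 r *v vec7 a b c d e f g = vec7 a (b + r * c) c d (e + r * f) f g"
  "root_elt 2 r *v vec7 a b c d e f g =
     vec7 (a - r * f) (b + r * g) c (d - r * c) (e + r^2 * c - 2 * r * d) f g"
  "root_elt 3 r *v vec7 a b c d e f g = vec7 (a + r * c) b c d (e + r * g) f g"
  "root_elt 4 r *v vec7 a b c d e f g =
     vec7 (a - 2 * r * d - r^2 * g) b c (d + r * g) (e + r * b) (f + r * c) g"
  "root_elt 5 r *v vec7 a b c d e f g = vec7 (a + r * b) b c d e (f - r * g) g"
  "root_elt 6 r *v vec7 a b c d e f g =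
     vec7 (a - r * e) b (c - r * g) (d - r * b) e (f - r^2 * b + 2 * r * d) g"
  "root_elt 7 r *v vec7 a b c d e f g = vec7 a b (c + r * b) d e (f + r * e) g"
  "root_elt 8 r *v vec7 a b c d e f g =
     vec7 a b (c - 2 * r * d + r^2 * e) (d - r * e) e (f - r * a) (g + r * b)"
  "root_elt 9 r *v vec7 a b c d e f g = vec7 a b (c + r * a) d e f (g + r * e)"
  "root_elt 10 r *v vec7 a b c d e f g =
     vec7 a (b + r * e) (c + r * f) (d - r * a) e f (g - r^2 * a + 2 * r * d)"
  "root_elt 11 r *v vec7 a b c d e f g = vec7 a (b + r * a) c d e f (g - r * f)"
  unfolding root_elt_pos x_mb_eq vec_eq_iff forall_7
  by (simp_all add: x_act root_elt_def matrix_vector_mult_add_rdistrib matrix_vector_mult_diff_rdistrib)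

lemma h_torus_act [simp]:
  "h_torus x y *v vec7 a b c d e f g =
     vec7 (x * a) (y * b) (inverse (x * y) * c) d (x * y * e) (inverse y * f) (inverse x * g)"
  unfolding h_torus_def vec_eq_iff forall_7
  by (simp add: matrix_vector_mult_add_rdistrib)

definition refl_a :: "'k::field^7^7" where
  "refl_a = E 1 5 1 - E 2 6 1 + E 3 7 1 - E 4 4 1 - E 5 1 1 - E 6 2 1 - E 7 3 1"

definition refl_b :: "'k::field^7^7" where
  "refl_b = E 1 2 1 - E 2 1 1 + E 3 3 1 + E 4 4 1 + E 5 5 1 - E 6 7 1 + E 7 6 1"

lemma refl_act [simp]:
  "refl_a *v vec7 a b c d e f g = vec7 e (- f) g (- d) (- a) (- b) (- c)"
  "refl_b *v vec7 a b c d e f g = vec7 b (- a) c d e (- g) f"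
  unfolding refl_a_def refl_b_def vec_eq_iff forall_7
  by (simp_all add: matrix_vector_mult_add_rdistrib matrix_vector_mult_diff_rdistrib)

lemmas matrix_act = matrix_vector_mul_assoc[symmetric] matrix_vector_mul_lid

lemma root_elt_add: "root_elt i r ** root_elt i t = root_elt i (r + t)"
proof -
  have "i mod 12 \<in> {0..11}" by simp
  then have "i mod 12 \<in> {0,1,2,3,4,5,6,7,8,9,10,11}"
    by (simp add: atLeastAtMost_iff) presburger
  then have "root_elt (i mod 12) r ** root_elt (i mod 12) t = root_elt (i mod 12) (r + t)"
    by (elim insertE emptyE; intro matrix_eq_vec7)
      (simp_all add: matrix_act algebra_simps power2_eq_square)
  then show ?thesis by (simp only: root_elt_mod)
qed

lemma root_elt_0: "root_elt i 0 = mat 1"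
  by (simp add: root_elt_def x_a_def x_ma_def x_b_def x_ab_def x_2ab_def x_3ab_def x_3a2b_def x_mb_eq
      E_def vec_eq_iff)

text \<open>Chevalley commutator relations, each arranged so that the left factor ends up at the far
  right. Those of \<alpha> and \<beta> give normality of the two unipotent radicals; those of
  \<alpha>+\<beta>, in particular the last one with -\<beta>, serve the root exchange.\<close>

lemma commutators:
  "root_elt 0 r ** root_elt 1 t = root_elt 1 t ** root_elt 0 r"
  "root_elt 0 r ** root_elt 2 t = root_elt 2 t ** root_elt 1 (3 * r * t) ** root_elt 0 r"
  "root_elt 0 r ** root_elt 3 t = root_elt 3 t ** root_elt 0 r"
  "root_elt 0 r ** root_elt 4 t = root_elt 4 t ** root_elt 2 (- 2 * r * t) **
     root_elt 1 (- 3 * r^2 * t) ** root_elt 3 (3 * r * t^2) ** root_elt 0 r"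
  "root_elt 0 r ** root_elt 5 t = root_elt 5 t ** root_elt 4 (- r * t) ** root_elt 2 (r^2 * t) **
     root_elt 1 (r^3 * t) ** root_elt 3 (r^3 * t^2) ** root_elt 0 r"
  "root_elt 5 r ** root_elt 0 t = root_elt 0 t ** root_elt 4 (r * t) ** root_elt 2 (r * t^2) **
     root_elt 1 (- r * t^3) ** root_elt 3 (- 2 * r^2 * t^3) ** root_elt 5 r"
  "root_elt 5 r ** root_elt 1 t = root_elt 1 t ** root_elt 3 (r * t) ** root_elt 5 r"
  "root_elt 5 r ** root_elt 2 t = root_elt 2 t ** root_elt 5 r"
  "root_elt 5 r ** root_elt 3 t = root_elt 3 t ** root_elt 5 r"
  "root_elt 5 r ** root_elt 4 t = root_elt 4 t ** root_elt 5 r"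
  "root_elt 4 r ** root_elt 0 t = root_elt 0 t ** root_elt 2 (2 * r * t) **
     root_elt 1 (- 3 * r * t^2) ** root_elt 3 (3 * r^2 * t) ** root_elt 4 r"
  "root_elt 4 r ** root_elt 1 t = root_elt 1 t ** root_elt 4 r"
  "root_elt 4 r ** root_elt 2 t = root_elt 2 t ** root_elt 3 (3 * r * t) ** root_elt 4 r"
  "root_elt 4 r ** root_elt 3 t = root_elt 3 t ** root_elt 4 r"
  "root_elt 4 r ** root_elt 11 t = root_elt 11 t ** root_elt 0 (- r * t) ** root_elt 2 (- (r^2) * t) **
     root_elt 1 (- (r^3) * t^2) ** root_elt 3 (- (r^3) * t) ** root_elt 4 r"
  by (intro matrix_eq_vec7;
      simp add: matrix_act algebra_simps power2_eq_square power3_eq_cube)+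

text \<open>The value of a root at \<open>h_torus a b\<close>. Everything follows from \<alpha>
  having value b and \<beta> having value a/b.\<close>

definition root_char :: "int \<Rightarrow> 'k::field \<Rightarrow> 'k \<Rightarrow> 'k" where
  "root_char i a b = (let j = i mod 6;
     c = (if j = 0 then b else if j = 1 then a * b^2 else if j = 2 then a * b
       else if j = 3 then a^2 * b else if j = 4 then a else a * inverse b)
     in if i mod 12 < 6 then c else inverse c)"

text \<open>The sign e = 1 or -1 distinguishes rotations from reflections of the dihedral Weyl
  group. The scale factors stay existential because the Bruhat argument only asks which root
  subgroup is reached.\<close>

definition acts_on_roots :: "'k::field^7^7 \<Rightarrow> int \<Rightarrow> int \<Rightarrow> bool" where
  "acts_on_roots n e m \<longleftrightarrow> (\<exists>c. (\<forall>i. c i \<noteq> 0) \<and>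
     (\<forall>i r. n ** root_elt i r = root_elt (e * i + m) (c i * r) ** n))"

lemma mod_12_cases:
  fixes i :: int
  obtains "i mod 12 = 0" | "i mod 12 = 1" | "i mod 12 = 2" | "i mod 12 = 3" | "i mod 12 = 4"
    | "i mod 12 = 5" | "i mod 12 = 6" | "i mod 12 = 7" | "i mod 12 = 8" | "i mod 12 = 9"
    | "i mod 12 = 10" | "i mod 12 = 11"
proof -
  have "i mod 12 = 0 \<or> i mod 12 = 1 \<or> i mod 12 = 2 \<or> i mod 12 = 3 \<or> i mod 12 = 4 \<or> i mod 12 = 5 \<or>
      i mod 12 = 6 \<or> i mod 12 = 7 \<or> i mod 12 = 8 \<or> i mod 12 = 9 \<or> i mod 12 = 10 \<or> i mod 12 = 11"
    by presburger
  then show thesis using that by metis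
qed

lemma root_elt_conj_mod:
  assumes "\<And>i r. i \<in> {0,1,2,3,4,5,6,7,8,9,10,11} \<Longrightarrow>
      n ** root_elt i r = root_elt (e * i + m) (c i * r) ** n"
    and "\<And>i. c (i mod 12) = c i"
  shows "n ** root_elt i r = root_elt (e * i + m) (c i * r) ** n"
proof -
  have "(e * (i mod 12) + m) mod 12 = (e * i + m) mod 12" by (metis mod_add_left_eq mod_mult_right_eq)
  then have "root_elt (e * (i mod 12) + m) t = root_elt (e * i + m) t" for t :: 'a
    by (metis root_elt_mod)
  moreover have "i mod 12 \<in> {0,1,2,3,4,5,6,7,8,9,10,11}" by (cases i rule: mod_12_cases) simp_all
  ultimately show ?thesis
    using assms(1)[of "i mod 12" r] assms(2)[of i] by (simp add: root_elt_mod)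
qed

lemma root_elt_neg_index:
  "root_elt (-1) r = root_elt 11 r" "root_elt (-2) r = root_elt 10 r" "root_elt (-3) r = root_elt 9 r"
  "root_elt (-4) r = root_elt 8 r" "root_elt (-5) r = root_elt 7 r" "root_elt (-6) r = root_elt 6 r"
  "root_elt (-7) r = root_elt 5 r"
  by (simp_all add: root_elt_def)

text \<open>The reflection in the root with index j maps i to 2j + 6 - i modulo 12: this is 6 - i
  for \<alpha> (j = 0) and 4 - i for \<beta> (j = 5). The signs depend on the chosen
  matrices.\<close>

lemma refl_a_conj:
  "refl_a ** root_elt i r = root_elt (6 - i) ((if i mod 6 < 3 then -1 else 1) * r) ** refl_a"
proof -
  have "refl_a ** root_elt i r = root_elt (-1 * i + 6) ((if i mod 6 < 3 then -1 else 1) * r) ** refl_a"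
  proof (rule root_elt_conj_mod)
    show "refl_a ** root_elt i r = root_elt (-1 * i + 6) ((if i mod 6 < 3 then -1 else 1) * r) ** refl_a"
      if "i \<in> {0,1,2,3,4,5,6,7,8,9,10,11}" for i and r :: 'a
      using that by (elim insertE emptyE; intro matrix_eq_vec7)
        (simp_all add: matrix_act root_elt_neg_index algebra_simps)
  qed (simp add: mod_mod_cancel)
  then show ?thesis by (simp add: algebra_simps)
qed

lemma refl_b_conj:
  "refl_b ** root_elt i r = root_elt (4 - i) ((if i mod 6 < 3 then 1 else -1) * r) ** refl_b"
proof -
  have "refl_b ** root_elt i r = root_elt (-1 * i + 4) ((if i mod 6 < 3 then 1 else -1) * r) ** refl_b"
  proof (rule root_elt_conj_mod)
    show "refl_b ** root_elt i r = root_elt (-1 * i + 4) ((if i mod 6 < 3 then 1 else -1) * r) ** refl_b"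
      if "i \<in> {0,1,2,3,4,5,6,7,8,9,10,11}" for i and r :: 'a
      using that by (elim insertE emptyE; intro matrix_eq_vec7)
        (simp_all add: matrix_act root_elt_neg_index algebra_simps)
  qed (simp add: mod_mod_cancel)
  then show ?thesis by (simp add: algebra_simps)
qed

lemma h_torus_conj:
  assumes "a \<noteq> 0" "b \<noteq> 0"
  shows "h_torus a b ** root_elt i r = root_elt i (root_char i a b * r) ** h_torus a b"
proof -
  have "h_torus a b ** root_elt i r = root_elt (1 * i + 0) (root_char i a b * r) ** h_torus a b"
  proof (rule root_elt_conj_mod)
    show "h_torus a b ** root_elt i r = root_elt (1 * i + 0) (root_char i a b * r) ** h_torus a b"
      if "i \<in> {0,1,2,3,4,5,6,7,8,9,10,11}" for i and r :: 'a
      using that assms by (elim insertE emptyE; intro matrix_eq_vec7)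
        (simp_all add: matrix_act root_char_def field_simps power2_eq_square)
  qed (simp add: root_char_def mod_mod_cancel)
  then show ?thesis by simp
qed

lemma root_char_nonzero: "a \<noteq> 0 \<Longrightarrow> b \<noteq> 0 \<Longrightarrow> root_char i a b \<noteq> 0"
  by (simp add: root_char_def Let_def)

lemma acts_mult:
  assumes "acts_on_roots n e m" "acts_on_roots n' e' m'"
  shows "acts_on_roots (n ** n') (e * e') (e * m' + m)"
proof -
  obtain c c' where c: "\<And>i. c i \<noteq> 0" "\<And>i r. n ** root_elt i r = root_elt (e * i + m) (c i * r) ** n"
    and c': "\<And>i. c' i \<noteq> 0" "\<And>i r. n' ** root_elt i r = root_elt (e' * i + m') (c' i * r) ** n'"
    using assms unfolding acts_on_roots_def by metis
  have "(n ** n') ** root_elt i r =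
      root_elt (e * e' * i + (e * m' + m)) ((c (e' * i + m') * c' i) * r) ** (n ** n')" for i r
  proof -
    have "(n ** n') ** root_elt i r = (n ** root_elt (e' * i + m') (c' i * r)) ** n'"
      by (metis c'(2) matrix_mul_assoc)
    also have "\<dots> = root_elt (e * (e' * i + m') + m) (c (e' * i + m') * (c' i * r)) ** (n ** n')"
      by (simp add: c(2) matrix_mul_assoc)
    finally show ?thesis by (simp add: algebra_simps)
  qed
  then show ?thesis unfolding acts_on_roots_def
    using c(1) c'(1) by (intro exI[of _ "\<lambda>i. c (e' * i + m') * c' i"]) simp
qed

lemma acts_refl_a: "acts_on_roots refl_a (-1) 6"
  unfolding acts_on_roots_def
  by (rule exI[of _ "\<lambda>i. if i mod 6 < 3 then -1 else 1"]) (simp add: refl_a_conj algebra_simps)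

lemma acts_refl_b: "acts_on_roots refl_b (-1) 4"
  unfolding acts_on_roots_def
  by (rule exI[of _ "\<lambda>i. if i mod 6 < 3 then 1 else -1"]) (simp add: refl_b_conj algebra_simps)

lemma acts_h_torus: "a \<noteq> 0 \<Longrightarrow> b \<noteq> 0 \<Longrightarrow> acts_on_roots (h_torus a b) 1 0"
  unfolding acts_on_roots_def
  by (rule exI[of _ "\<lambda>i. root_char i a b"]) (simp add: h_torus_conj root_char_nonzero)

lemma h_torus_mult: "h_torus a b ** h_torus c d = h_torus (a * c) (b * d)"
  by (intro matrix_eq_vec7) (simp add: matrix_act algebra_simps)

lemma h_torus_1: "h_torus 1 1 = mat 1"
  by (intro matrix_eq_vec7) (simp add: matrix_act)

text \<open>Simple roots are encoded as booleans: \<open>True\<close> is \<open>\<alpha>\<close> and \<open>False\<close> is \<open>\<beta>\<close>.\<close>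

definition simple_refl :: "bool \<Rightarrow> 'k::field^7^7" where
  "simple_refl x = (if x then refl_a else refl_b)"

fun weyl_word :: "bool \<Rightarrow> nat \<Rightarrow> 'k::field^7^7" where
  "weyl_word x 0 = mat 1"
| "weyl_word x (Suc k) = simple_refl x ** weyl_word (\<not> x) k"

fun weyl_shift :: "bool \<Rightarrow> nat \<Rightarrow> int" where
  "weyl_shift x 0 = 0"
| "weyl_shift x (Suc k) = (if x then 6 else 4) - weyl_shift (\<not> x) k"

text \<open>The Weyl group is dihedral of order 12, so each element is represented by an alternating
  word of length at most 6 in the simple reflections.\<close>

definition weyl_torus :: "('k::field^7^7) set" where
  "weyl_torus = {weyl_word x k ** h_torus a b | x k a b. k \<le> 6 \<and> a \<noteq> 0 \<and> b \<noteq> 0}"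

lemma acts_weyl_word: "acts_on_roots (weyl_word x k) ((-1)^k) (weyl_shift x k)"
proof (induction k arbitrary: x)
  case 0
  then show ?case by (simp add: acts_h_torus[of 1 1, unfolded h_torus_1])
next
  case (Suc k)
  have "acts_on_roots (simple_refl x) (-1) (if x then 6 else 4)"
    by (simp add: simple_refl_def acts_refl_a acts_refl_b)
  from acts_mult[OF this Suc[of "\<not> x"]] show ?case by simp
qed

lemma acts_weyl_torus:
  "\<lbrakk>a \<noteq> 0; b \<noteq> 0\<rbrakk> \<Longrightarrow> acts_on_roots (weyl_word x k ** h_torus a b) ((-1)^k) (weyl_shift x k)"
  using acts_mult[OF acts_weyl_word acts_h_torus] by force

text \<open>The braid relation of length 6. It holds for these representatives themselves, not
  merely modulo the torus.\<close>

lemma weyl_word_6: "weyl_word x 6 = weyl_word True 6"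
proof -
  have "weyl_word False 6 = (weyl_word True 6 :: 'a^7^7)"
    by (intro matrix_eq_vec7) (simp add: eval_nat_numeral simple_refl_def matrix_act)
  then show ?thesis by (cases x) auto
qed

lemma refl_sq: "simple_refl x ** simple_refl x = h_torus (-1) (if x then 1 else -1)"
  by (intro matrix_eq_vec7) (simp add: simple_refl_def matrix_act)

lemma refl_torus:
  "a \<noteq> 0 \<Longrightarrow> b \<noteq> 0 \<Longrightarrow>
   h_torus a b ** simple_refl x = simple_refl x ** (if x then h_torus (a * b) (inverse b) else h_torus b a)"
  by (intro matrix_eq_vec7) (simp add: simple_refl_def matrix_act field_simps)

lemma weyl_word_torus:
  "a \<noteq> 0 \<Longrightarrow> b \<noteq> 0 \<Longrightarrow>
   \<exists>c d. c \<noteq> 0 \<and> d \<noteq> 0 \<and> h_torus a b ** weyl_word x k = weyl_word x k ** h_torus c d"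
proof (induction k arbitrary: a b x)
  case 0
  then show ?case by auto
next
  case (Suc k)
  obtain a' b' where ab': "a' \<noteq> 0" "b' \<noteq> 0" "h_torus a b ** simple_refl x = simple_refl x ** h_torus a' b'"
  proof (cases x)
    case True
    then show thesis using that[of "a * b" "inverse b"] refl_torus[OF Suc.prems, of x] Suc.prems by simp
  next
    case False
    then show thesis using that[of b a] refl_torus[OF Suc.prems, of x] Suc.prems by simp
  qed
  obtain c d where cd: "c \<noteq> 0" "d \<noteq> 0"
      "h_torus a' b' ** weyl_word (\<not> x) k = weyl_word (\<not> x) k ** h_torus c d"
    using Suc.IH[OF ab'(1,2)] by blast
  have "h_torus a b ** weyl_word x (Suc k) = weyl_word x (Suc k) ** h_torus c d"
  proof -
    have "h_torus a b ** weyl_word x (Suc k) = (h_torus a b ** simple_refl x) ** weyl_word (\<not> x) k"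
      by (simp add: matrix_mul_assoc)
    also have "\<dots> = simple_refl x ** (h_torus a' b' ** weyl_word (\<not> x) k)"
      by (simp add: ab'(3) matrix_mul_assoc)
    also have "\<dots> = weyl_word x (Suc k) ** h_torus c d"
      by (simp add: cd(3) matrix_mul_assoc)
    finally show ?thesis .
  qed
  with cd(1,2) show ?case by blast
qed

lemma weyl_torus_word: "k \<le> 6 \<Longrightarrow> a \<noteq> 0 \<Longrightarrow> b \<noteq> 0 \<Longrightarrow> weyl_word x k ** h_torus a b \<in> weyl_torus"
  unfolding weyl_torus_def by blast

lemma h_torus_weyl_torus:
  assumes "a \<noteq> 0" "b \<noteq> 0" "n \<in> weyl_torus"
  shows "h_torus a b ** n \<in> weyl_torus"
proof -
  obtain x k c d where n: "n = weyl_word x k ** h_torus c d" "k \<le> 6" "c \<noteq> 0" "d \<noteq> 0"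
    using assms(3) unfolding weyl_torus_def by blast
  obtain c' d' where *: "c' \<noteq> 0" "d' \<noteq> 0" "h_torus a b ** weyl_word x k = weyl_word x k ** h_torus c' d'"
    using weyl_word_torus[OF assms(1,2)] by blast
  have "h_torus a b ** n = weyl_word x k ** h_torus (c' * c) (d' * d)"
  proof -
    have "h_torus a b ** n = (h_torus a b ** weyl_word x k) ** h_torus c d"
      by (simp add: n(1) matrix_mul_assoc)
    also have "\<dots> = weyl_word x k ** (h_torus c' d' ** h_torus c d)"
      by (simp only: *(3) matrix_mul_assoc)
    finally show ?thesis by (simp only: h_torus_mult)
  qed
  then show ?thesis using weyl_torus_word[of k "c' * c" "d' * d" x] n(2-4) *(1,2) by simp
qed

lemma refl_weyl_torus:
  assumes "n \<in> weyl_torus"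
  shows "simple_refl x ** n \<in> weyl_torus"
proof -
  obtain y k c d where n: "n = weyl_word y k ** h_torus c d" "k \<le> 6" "c \<noteq> 0" "d \<noteq> 0"
    using assms unfolding weyl_torus_def by blast
  have up: "simple_refl x ** (weyl_word (\<not> x) l ** h_torus c d) \<in> weyl_torus" if "l \<le> 5" for l
    using weyl_torus_word[of "Suc l" c d x] that n by (simp add: matrix_mul_assoc)
  have down: "simple_refl x ** (weyl_word x (Suc l) ** h_torus c d) \<in> weyl_torus" if "l \<le> 5" for l
  proof -
    have "simple_refl x ** (weyl_word x (Suc l) ** h_torus c d) =
        h_torus (-1) (if x then 1 else -1) ** (weyl_word (\<not> x) l ** h_torus c d)"
      by (simp add: matrix_mul_assoc refl_sq)
    then show ?thesis using h_torus_weyl_torus[OF _ _ weyl_torus_word[of l c d "\<not> x"]] that n by simp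
  qed
  show ?thesis
  proof (cases "k = 0")
    case True
    then show ?thesis using up[of 0] n by simp
  next
    case k: False
    show ?thesis
    proof (cases "y = x")
      case True
      then show ?thesis using down[of "k - 1"] n k by simp
    next
      case False
      show ?thesis
      proof (cases "k = 6")
        case True
        \<comment> \<open>A longest word cannot be lengthened. The braid relation rewrites it to
          begin with \<open>x\<close>, so that multiplying by the reflection shortens it.\<close>
        have "weyl_word y 6 = (weyl_word x 6 :: 'a^7^7)" by (metis weyl_word_6)
        moreover have "Suc 5 = 6" by simp
        ultimately show ?thesis using down[of 5] n(1) True by (metis order_refl)
      next
        case False
        then have "y = (\<not> x)" "k \<le> 5" using \<open>y \<noteq> x\<close> n(2) by auto
        then show ?thesis using up[of k] n by simp
      qed
    qed
  qed
qed

definition simple_root :: "bool \<Rightarrow> int" where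
  "simple_root x = (if x then 0 else 5)"

text \<open>The rank-one big-cell identity in the SL_2 of a simple root. It trades a positive root
  element next to a reflection for a negative one.\<close>

lemma refl_root_elt:
  assumes "r \<noteq> 0"
  shows "\<exists>a b. a \<noteq> 0 \<and> b \<noteq> 0 \<and> simple_refl x ** root_elt (simple_root x) r =
     root_elt (simple_root x) (- inverse r) ** h_torus a b ** root_elt (simple_root x + 6) (inverse r)"
proof (cases x)
  case True
  have "refl_a ** root_elt 0 r =
      root_elt 0 (- inverse r) ** h_torus (- r) (inverse (r^2)) ** root_elt 6 (inverse r)"
    using assms by (intro matrix_eq_vec7) (simp add: matrix_act field_simps power2_eq_square)
  then show ?thesis using True assms unfolding simple_refl_def simple_root_def
    by (intro exI[of _ "- r"] exI[of _ "inverse (r^2)"]) simp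
next
  case False
  have "refl_b ** root_elt 5 r =
      root_elt 5 (- inverse r) ** h_torus (- inverse r) (- r) ** root_elt 11 (inverse r)"
    using assms by (intro matrix_eq_vec7) (simp add: matrix_act field_simps power2_eq_square)
  then show ?thesis using False assms unfolding simple_refl_def simple_root_def
    by (intro exI[of _ "- inverse r"] exI[of _ "- r"]) simp
qed

text \<open>The same rank-one identity solved for the negative root element; it reduces the negative
  generators of \<open>G2\<close> to U, torus and reflection.\<close>

lemma neg_simple_root_elt:
  assumes "r \<noteq> 0"
  shows "\<exists>a b. a \<noteq> 0 \<and> b \<noteq> 0 \<and> root_elt (simple_root x + 6) r =
     root_elt (simple_root x) (inverse r) ** h_torus a b ** simple_refl x ** root_elt (simple_root x) (inverse r)"
proof (cases x)
  case True
  have "root_elt 6 r =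
      root_elt 0 (inverse r) ** h_torus (- r) (inverse (r^2)) ** refl_a ** root_elt 0 (inverse r)"
    using assms by (intro matrix_eq_vec7) (simp add: matrix_act field_simps power2_eq_square)
  then show ?thesis using True assms unfolding simple_refl_def simple_root_def
    by (intro exI[of _ "- r"] exI[of _ "inverse (r^2)"]) simp
next
  case False
  have "root_elt 11 r =
      root_elt 5 (inverse r) ** h_torus (- inverse r) (- r) ** refl_b ** root_elt 5 (inverse r)"
    using assms by (intro matrix_eq_vec7) (simp add: matrix_act field_simps power2_eq_square)
  then show ?thesis using False assms unfolding simple_refl_def simple_root_def
    by (intro exI[of _ "- inverse r"] exI[of _ "- r"]) simp
qed


section \<open>The Bruhat decomposition\<close>

definition root_gens :: "int set \<Rightarrow> ('k::field^7^7) set" where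
  "root_gens I = (\<Union>i\<in>I. range (root_elt i))"

definition root_group :: "int set \<Rightarrow> ('k::field^7^7) set" where
  "root_group I = generate GL (root_gens I)"

lemma root_elt_inverse: "root_elt i r ** root_elt i (- r) = mat 1" "root_elt i (- r) ** root_elt i r = mat 1"
  by (simp_all add: root_elt_add root_elt_0)

lemma mult_eq_assoc: "A ** B = C \<Longrightarrow> A ** (B ** X) = C ** X"
  by (simp add: matrix_mul_assoc)

lemma root_gens_GL: "root_gens I \<subseteq> carrier GL"
  unfolding root_gens_def GL_def invertible_def using root_elt_inverse by fastforce

lemma inv_root_elt: "inv\<^bsub>GL\<^esub> (root_elt i r) = root_elt i (- r)"
  by (intro group.inv_equality[OF group_GL])
    (auto simp: GL_def invertible_def root_elt_inverse intro: exI[of _ "root_elt i r"]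
        exI[of _ "root_elt i (- r)"])

lemma subgroup_root_group: "subgroup (root_group I) GL"
  unfolding root_group_def by (rule group.generate_is_subgroup[OF group_GL root_gens_GL])

lemma root_group_mult: "u \<in> root_group I \<Longrightarrow> v \<in> root_group I \<Longrightarrow> u ** v \<in> root_group I"
  using subgroup.m_closed[OF subgroup_root_group] by (fastforce simp: GL_def)

lemma root_group_one: "mat 1 \<in> root_group I"
  using subgroup.one_closed[OF subgroup_root_group, of I] by (simp add: GL_def)

lemma root_group_elt: "i \<in> I \<Longrightarrow> root_elt i r \<in> root_group I"
  unfolding root_group_def root_gens_def by (auto intro: generate.incl)

lemma matrix_inv_mult:
  assumes "invertible A"
  shows "matrix_inv A ** A = mat 1" "A ** matrix_inv A = mat 1"
proof -
  have "A ** matrix_inv A = mat 1 \<and> matrix_inv A ** A = mat 1"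
    unfolding matrix_inv_def using assms unfolding invertible_def by (rule someI_ex)
  then show "matrix_inv A ** A = mat 1" "A ** matrix_inv A = mat 1" by simp_all
qed

lemma inv_GL: "invertible A \<Longrightarrow> inv\<^bsub>GL\<^esub> A = matrix_inv A"
  by (intro group.inv_equality[OF group_GL])
    (auto simp: GL_def matrix_inv_mult invertible_def[of "matrix_inv A"] intro: exI[of _ A])

lemma root_group_invertible: "u \<in> root_group I \<Longrightarrow> invertible u"
  using subgroup.mem_carrier[OF subgroup_root_group] by (fastforce simp: GL_def)

lemma root_group_inv: "u \<in> root_group I \<Longrightarrow> matrix_inv u \<in> root_group I"
  using subgroup.m_inv_closed[OF subgroup_root_group] inv_GL root_group_invertible by metis

lemma root_group_induct [consumes 1, case_names one mult]:
  assumes "u \<in> root_group I"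
    and one: "P (mat 1)"
    and mult: "\<And>i r v. i \<in> I \<Longrightarrow> v \<in> root_group I \<Longrightarrow> P v \<Longrightarrow> P (root_elt i r ** v)"
  shows "P u"
proof -
  \<comment> \<open>The claim is strengthened to left multiplication on an arbitrary v, so that the
    product case of \<open>generate\<close> is a composition. Inverses of generators are generators
    again, which is why the rule has no inverse case.\<close>
  have "\<forall>v. v \<in> root_group I \<and> P v \<longrightarrow> u ** v \<in> root_group I \<and> P (u ** v)"
    using assms(1) unfolding root_group_def[of I]
  proof (induction rule: generate.induct)
    case one
    then show ?case by (simp add: GL_def)
  next
    case (incl h)
    then obtain i r where "i \<in> I" "h = root_elt i r" unfolding root_gens_def by blast
    then show ?case
      using mult root_group_mult root_group_elt by (metis root_group_def)
  next
    case (inv h)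
    then obtain i r where "i \<in> I" "h = root_elt i r" unfolding root_gens_def by blast
    then show ?case
      using mult root_group_mult root_group_elt unfolding inv_root_elt \<open>h = root_elt i r\<close>
      by (metis root_group_def)
  next
    case (eng h1 h2)
    then show ?case by (simp add: GL_def matrix_mul_assoc[symmetric])
  qed
  then have "P (u ** mat 1)" using one root_group_one by blast
  then show ?thesis by simp
qed

lemma root_gens_eq:
  "range x_a \<union> range x_ab \<union> range x_2ab \<union> range x_3ab \<union> range x_3a2b = root_gens {0, 1, 2, 3, 4}"
  "range x_b \<union> range x_ab \<union> range x_2ab \<union> range x_3ab \<union> range x_3a2b = root_gens {1, 2, 3, 4, 5}"
  "range x_a \<union> range x_b \<union> range x_ab \<union> range x_2ab \<union> range x_3ab \<union> range x_3a2b
     = root_gens {0, 1, 2, 3, 4, 5}"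
  "range x_a \<union> range x_ma \<union> range x_b \<union> range x_mb = root_gens {0, 5, 6, 11}"
  unfolding root_gens_def by (simp_all add: root_elt_pos[abs_def] Un_ac)

lemma root_group_eq:
  "V_rad = root_group {0, 1, 2, 3, 4}" "V'_rad = root_group {1, 2, 3, 4, 5}"
  "U_borel = root_group {0, 1, 2, 3, 4, 5}" "G2 = root_group {0, 5, 6, 11}"
  unfolding V_rad_def V'_rad_def U_borel_def G2_def root_group_def by (simp_all only: root_gens_eq)

lemma root_group_mono: "I \<subseteq> J \<Longrightarrow> u \<in> root_group I \<Longrightarrow> u \<in> root_group J"
  unfolding root_group_def
  using group.mono_generate[OF group_GL, of "root_gens I" "root_gens J"] by (auto simp: root_gens_def)

lemma root_group_normal:
  assumes "\<And>i r. i \<in> I \<Longrightarrow> \<exists>v\<in>root_group J. n ** root_elt i r = v ** n"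
    and "u \<in> root_group I"
  shows "\<exists>v\<in>root_group J. n ** u = v ** n"
  using assms(2)
proof (induction rule: root_group_induct)
  case one
  then show ?case using root_group_one by (metis matrix_mul_lid matrix_mul_rid)
next
  case (mult i r u)
  obtain v where v: "v \<in> root_group J" "n ** u = v ** n" using mult.IH by blast
  obtain w where w: "w \<in> root_group J" "n ** root_elt i r = w ** n" using assms(1)[OF mult.hyps(1)] by blast
  have "n ** (root_elt i r ** u) = (n ** root_elt i r) ** u" by (simp add: matrix_mul_assoc)
  also have "\<dots> = w ** (n ** u)" by (simp add: w(2) matrix_mul_assoc)
  also have "\<dots> = (w ** v) ** n" by (simp add: v(2) matrix_mul_assoc)
  finally show ?case using root_group_mult[OF w(1) v(1)] by blast
qed

definition radical_roots :: "bool \<Rightarrow> int set" where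
  "radical_roots x = (if x then {1, 2, 3, 4, 5} else {0, 1, 2, 3, 4})"

lemma root_elt_0_normal:
  assumes "i \<in> {1, 2, 3, 4, 5}"
  shows "\<exists>v\<in>root_group {1, 2, 3, 4, 5}. root_elt 0 r ** root_elt i t = v ** root_elt 0 r"
proof -
  have *: "root_elt i t \<in> root_group {1, 2, 3, 4, 5}" if "i \<in> {1, 2, 3, 4, 5}" for i and t :: 'a
    using that by (rule root_group_elt)
  from assms show ?thesis
    by (elim insertE emptyE; hypsubst)
      (rule bexI, rule commutators(1-5), (intro root_group_mult *; simp))+
qed

lemma root_elt_5_normal:
  assumes "i \<in> {0, 1, 2, 3, 4}"
  shows "\<exists>v\<in>root_group {0, 1, 2, 3, 4}. root_elt 5 r ** root_elt i t = v ** root_elt 5 r"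
proof -
  have *: "root_elt i t \<in> root_group {0, 1, 2, 3, 4}" if "i \<in> {0, 1, 2, 3, 4}" for i and t :: 'a
    using that by (rule root_group_elt)
  from assms show ?thesis
    by (elim insertE emptyE; hypsubst)
      (rule bexI, rule commutators(6-10), (intro root_group_mult *; simp))+
qed

lemma radical_normal_simple:
  assumes "v \<in> root_group (radical_roots x)"
  shows "\<exists>v'\<in>root_group (radical_roots x). root_elt (simple_root x) r ** v = v' ** root_elt (simple_root x) r"
proof (rule root_group_normal[OF _ assms])
  show "\<exists>v\<in>root_group (radical_roots x). root_elt (simple_root x) r ** root_elt i t = v ** root_elt (simple_root x) r"
    if "i \<in> radical_roots x" for i t
    using that root_elt_0_normal[of i r t] root_elt_5_normal[of i r t]
    by (cases x) (simp_all only: radical_roots_def simple_root_def if_True if_False)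
qed

text \<open>A simple reflection permutes the positive roots other than its own: 6 - i preserves
  {1,...,5} and 4 - i preserves {0,...,4}.\<close>

lemma radical_normal_refl:
  assumes "v \<in> root_group (radical_roots x)"
  shows "\<exists>v'\<in>root_group (radical_roots x). simple_refl x ** v = v' ** simple_refl x"
proof (rule root_group_normal[OF _ assms])
  fix i :: int and t :: 'a
  assume "i \<in> radical_roots x"
  then have "(if x then 6 else 4) - i \<in> radical_roots x"
    by (auto simp: radical_roots_def)
  then show "\<exists>v\<in>root_group (radical_roots x). simple_refl x ** root_elt i t = v ** simple_refl x"
    unfolding simple_refl_def using root_group_elt refl_a_conj refl_b_conj by (cases x) fastforce+
qed

lemma U_borel_decomp:
  assumes "u \<in> U_borel"
  shows "\<exists>v\<in>root_group (radical_roots x). \<exists>r. u = v ** root_elt (simple_root x) r"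
  using assms unfolding root_group_eq
proof (induction rule: root_group_induct)
  case one
  show ?case using root_group_one root_elt_0 by (metis matrix_mul_lid)
next
  case (mult i t u)
  obtain v r where v: "v \<in> root_group (radical_roots x)" "u = v ** root_elt (simple_root x) r"
    using mult.IH by blast
  show ?case
  proof (cases "i \<in> radical_roots x")
    case True
    have "root_elt i t ** u = (root_elt i t ** v) ** root_elt (simple_root x) r"
      by (simp add: v(2) matrix_mul_assoc)
    then show ?thesis using root_group_mult[OF root_group_elt[OF True] v(1)] by blast
  next
    case False
    then have i: "i = simple_root x" using mult.hyps(1)
      by (auto simp: radical_roots_def simple_root_def split: if_splits)
    obtain v' where v': "v' \<in> root_group (radical_roots x)"
        "root_elt i t ** v = v' ** root_elt i t"
      using radical_normal_simple[OF v(1), of t] i by blast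
    have "root_elt i t ** u = v' ** (root_elt i t ** root_elt i r)"
      by (simp add: v(2) matrix_mul_assoc v'(2) i[symmetric])
    then show ?thesis using v'(1) i by (metis root_elt_add)
  qed
qed

lemma U_borel_elt: "i mod 12 < 6 \<Longrightarrow> root_elt i r \<in> U_borel"
proof -
  assume *: "i mod 12 < 6"
  then have "i mod 12 \<in> {0,1,2,3,4,5}" by (cases i rule: mod_12_cases) simp_all
  then show ?thesis unfolding root_group_eq using root_group_elt root_elt_mod by metis
qed

lemma U_borel_mult: "u \<in> U_borel \<Longrightarrow> v \<in> U_borel \<Longrightarrow> u ** v \<in> U_borel"
  unfolding root_group_eq by (rule root_group_mult)

lemma radical_U_borel: "u \<in> root_group (radical_roots x) \<Longrightarrow> u \<in> U_borel"
  unfolding root_group_eq by (erule root_group_mono[rotated]) (auto simp: radical_roots_def)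

lemma acts_right:
  assumes "acts_on_roots n e m" "e * e = 1"
  shows "\<exists>s. root_elt i r ** n = n ** root_elt (e * (i - m)) s"
proof -
  obtain c where c: "\<And>i. c i \<noteq> 0" "\<And>i r. n ** root_elt i r = root_elt (e * i + m) (c i * r) ** n"
    using assms(1) unfolding acts_on_roots_def by metis
  have "e * (e * (i - m)) + m = (e * e) * (i - m) + m" by (simp only: mult.assoc)
  then have "e * (e * (i - m)) + m = i" using assms(2) by simp
  then have "n ** root_elt (e * (i - m)) (r / c (e * (i - m))) = root_elt i r ** n"
    using c(2)[of "e * (i - m)" "r / c (e * (i - m))"] c(1) by simp
  then show ?thesis by metis
qed

definition bruhat_set :: "('k::field^7^7) set" where
  "bruhat_set = {u ** n ** u' | u n u'. u \<in> U_borel \<and> n \<in> weyl_torus \<and> u' \<in> U_borel}"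

lemma bruhat_setI: "u \<in> U_borel \<Longrightarrow> n \<in> weyl_torus \<Longrightarrow> u' \<in> U_borel \<Longrightarrow> u ** n ** u' \<in> bruhat_set"
  unfolding bruhat_set_def by blast

lemma bruhat_left_U:
  assumes "u \<in> U_borel" "g \<in> bruhat_set"
  shows "u ** g \<in> bruhat_set"
proof -
  obtain v n v' where g: "g = v ** n ** v'" "v \<in> U_borel" "n \<in> weyl_torus" "v' \<in> U_borel"
    using assms(2) unfolding bruhat_set_def by blast
  then show ?thesis
    using bruhat_setI[OF U_borel_mult[OF assms(1) g(2)] g(3,4)] by (simp add: matrix_mul_assoc)
qed

lemma h_torus_U_borel:
  assumes "a \<noteq> 0" "b \<noteq> 0" "u \<in> U_borel"
  shows "\<exists>v\<in>U_borel. h_torus a b ** u = v ** h_torus a b"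
  unfolding root_group_eq
  by (rule root_group_normal[OF _ assms(3)[unfolded root_group_eq]], rule bexI,
      rule h_torus_conj[OF assms(1,2)], rule root_group_elt)

lemma bruhat_left_torus:
  assumes "a \<noteq> 0" "b \<noteq> 0" "g \<in> bruhat_set"
  shows "h_torus a b ** g \<in> bruhat_set"
proof -
  obtain u n u' where g: "g = u ** n ** u'" "u \<in> U_borel" "n \<in> weyl_torus" "u' \<in> U_borel"
    using assms(3) unfolding bruhat_set_def by blast
  obtain v where v: "v \<in> U_borel" "h_torus a b ** u = v ** h_torus a b"
    using h_torus_U_borel[OF assms(1,2) g(2)] by blast
  have "h_torus a b ** g = v ** (h_torus a b ** n) ** u'"
    by (simp add: g(1) matrix_mul_assoc v(2))
  then show ?thesis using bruhat_setI[OF v(1) h_torus_weyl_torus[OF assms(1,2) g(3)] g(4)] by simp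
qed

text \<open>The exchange axiom of a BN-pair: s U n U lies in the union of the double cosets of n and
  of sn. Only the simple root coordinate of u matters, since s normalises the rest.\<close>

lemma bruhat_left_refl:
  assumes "g \<in> bruhat_set"
  shows "simple_refl x ** g \<in> bruhat_set"
proof -
  obtain u n u' where g: "g = u ** n ** u'" "u \<in> U_borel" "n \<in> weyl_torus" "u' \<in> U_borel"
    using assms unfolding bruhat_set_def by blast
  obtain v t where v: "v \<in> root_group (radical_roots x)" "u = v ** root_elt (simple_root x) t"
    using U_borel_decomp[OF g(2)] by blast
  obtain v' where v': "v' \<in> root_group (radical_roots x)" "simple_refl x ** v = v' ** simple_refl x"
    using radical_normal_refl[OF v(1)] by blast
  have eq: "simple_refl x ** g = v' ** (simple_refl x ** root_elt (simple_root x) t ** n ** u')"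
    by (simp add: g(1) v(2) v'(2) matrix_mul_assoc)
  obtain y k a b where n: "n = weyl_word y k ** h_torus a b" "a \<noteq> 0" "b \<noteq> 0"
    using g(3) unfolding weyl_torus_def by blast
  define e :: int where "e = (-1)^k"
  define m where "m = weyl_shift y k"
  define j where "j = e * (simple_root x - m)"
  have e: "e = 1 \<or> e = -1" unfolding e_def minus_one_power_iff by auto
  have acts_on_roots: "acts_on_roots n e m" unfolding n e_def m_def by (rule acts_weyl_torus[OF n(2,3)])
  have ee: "e * e = 1" using e by auto
  \<comment> \<open>Here \<open>j\<close> is the index of the simple root moved by the inverse of n.
    If it is positive, the root element passes through n into the right-hand U; otherwise the
    rank-one identity first replaces it by an element of the opposite root.\<close>
  have "simple_refl x ** root_elt (simple_root x) t ** n ** u' \<in> bruhat_set"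
  proof (cases "j mod 12 < 6 \<or> t = 0")
    case True
    obtain s where s: "root_elt (simple_root x) t ** n = n ** root_elt j s" "root_elt j s \<in> U_borel"
    proof (cases "t = 0")
      case True
      then show thesis using that[of 0] root_group_one[of "{0,1,2,3,4,5}", folded root_group_eq]
        by (simp add: root_elt_0)
    next
      case False
      then show thesis using that acts_right[OF acts_on_roots ee, of "simple_root x" t] U_borel_elt[of j]
          \<open>j mod 12 < 6 \<or> t = 0\<close>
        unfolding j_def by blast
    qed
    have "simple_refl x ** root_elt (simple_root x) t ** n ** u' = mat 1 ** (simple_refl x ** n) ** (root_elt j s ** u')"
      by (simp add: matrix_mul_assoc[symmetric] mult_eq_assoc[OF s(1)])
    also have "\<dots> \<in> bruhat_set"
      using bruhat_setI[OF _ refl_weyl_torus[OF g(3)] U_borel_mult[OF s(2) g(4)]]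
        root_group_one[of "{0,1,2,3,4,5}", folded root_group_eq] by blast
    finally show ?thesis .
  next
    case False
    then obtain c d where cd: "c \<noteq> 0" "d \<noteq> 0" "simple_refl x ** root_elt (simple_root x) t =
        root_elt (simple_root x) (- inverse t) ** h_torus c d ** root_elt (simple_root x + 6) (inverse t)"
      using refl_root_elt[of t x] by blast
    obtain s where s: "root_elt (simple_root x + 6) (inverse t) ** n = n ** root_elt (e * (simple_root x + 6 - m)) s"
      using acts_right[OF acts_on_roots ee] by blast
    have "e * (simple_root x + 6 - m) = j + e * 6" by (simp add: j_def algebra_simps)
    \<comment> \<open>Adding 6 negates a root, and e * 6 is 6 or -6, so the negative root
      \<open>j\<close> is turned into a positive one.\<close>
    then have "e * (simple_root x + 6 - m) mod 12 < 6" using False e by auto presburger+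
    then have U: "root_elt (e * (simple_root x + 6 - m)) s ** u' \<in> U_borel"
      using U_borel_mult[OF U_borel_elt g(4)] by blast
    have "simple_refl x ** root_elt (simple_root x) t ** n ** u' =
        root_elt (simple_root x) (- inverse t) ** (h_torus c d ** n) **
          (root_elt (e * (simple_root x + 6 - m)) s ** u')"
      by (simp add: cd(3) matrix_mul_assoc[symmetric] mult_eq_assoc[OF s])
    also have "\<dots> \<in> bruhat_set"
      by (intro bruhat_setI h_torus_weyl_torus cd g U U_borel_elt) (simp add: simple_root_def)
    finally show ?thesis .
  qed
  then show ?thesis using bruhat_left_U[OF radical_U_borel[OF v'(1)]] eq by simp
qed

text \<open>\<open>bruhat_set\<close> contains 1 and is stable under left multiplication by the
  generators of \<open>G2\<close>.\<close>

theorem bruhat_decomposition: "G2 \<subseteq> bruhat_set"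
proof
  fix g :: "'a^7^7"
  assume "g \<in> G2"
  then show "g \<in> bruhat_set" unfolding root_group_eq
  proof (induction rule: root_group_induct)
    case one
    have "weyl_word True 0 ** h_torus 1 1 \<in> weyl_torus" by (rule weyl_torus_word) simp_all
    then show ?case using bruhat_setI[of "mat 1" "mat 1" "mat 1"]
        root_group_one[of "{0,1,2,3,4,5}", folded root_group_eq] by (simp add: h_torus_1)
  next
    case (mult i r g)
    have neg: "root_elt (simple_root x + 6) r ** g \<in> bruhat_set" for x
    proof (cases "r = 0")
      case True
      then show ?thesis using mult by (simp add: root_elt_0)
    next
      case False
      then obtain a b where ab: "a \<noteq> 0" "b \<noteq> 0" "root_elt (simple_root x + 6) r =
          root_elt (simple_root x) (inverse r) ** h_torus a b ** simple_refl x ** root_elt (simple_root x) (inverse r)"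
        using neg_simple_root_elt[of r x] by blast
      have U: "root_elt (simple_root x) (inverse r) \<in> U_borel"
        by (rule U_borel_elt) (simp add: simple_root_def)
      have "root_elt (simple_root x) (inverse r) ** (h_torus a b ** (simple_refl x **
          (root_elt (simple_root x) (inverse r) ** g))) \<in> bruhat_set"
        by (intro bruhat_left_U bruhat_left_torus bruhat_left_refl U ab mult.IH)
      then show ?thesis by (simp add: ab(3) matrix_mul_assoc)
    qed
    have "i = 0 \<or> i = 5 \<or> i = simple_root True + 6 \<or> i = simple_root False + 6"
      using mult.hyps(1) by (auto simp: simple_root_def)
    then show ?case using neg bruhat_left_U[OF U_borel_elt mult.IH] by auto
  qed
qed


section \<open>The anti-automorphism of the Gelfand--Kazhdan argument\<close>

text \<open>With respect to the order \<open>5 > 1 > 2 > 4 > 6 > 7 > 3\<close> of the basis, \<open>U_borel\<close> is upper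
  unitriangular.\<close>

definition borel_pos :: "7 \<Rightarrow> nat" where
  "borel_pos i = (if i = 5 then 0 else if i = 1 then 1 else if i = 2 then 2 else if i = 4 then 3
     else if i = 6 then 4 else if i = 7 then 5 else 6)"

definition borel_unitriangular :: "'k::field^7^7 \<Rightarrow> bool" where
  "borel_unitriangular A \<longleftrightarrow>
     (\<forall>i j. borel_pos j \<le> borel_pos i \<longrightarrow> A$i$j = (if i = j then 1 else 0))"

lemma borel_unitriangular_mult:
  assumes "borel_unitriangular A" "borel_unitriangular B"
  shows "borel_unitriangular (A ** B)"
  using assms unfolding borel_unitriangular_def forall_7
  by (simp add: borel_pos_def matrix_matrix_mult_def sum_7)

text \<open>The sum of the coordinates along U_\<alpha> and U_\<beta>, which sit in the entries
  (4,6) and (1,2). Both entries are adjacent to the diagonal in the order of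
  \<open>borel_pos\<close>, hence additive on products, and \<psi> of the sum is a generic
  character.\<close>

definition simple_sum :: "'k::field^7^7 \<Rightarrow> 'k" where
  "simple_sum u = u$4$6 + u$1$2"

lemma simple_sum_mult:
  assumes "borel_unitriangular A" "borel_unitriangular B"
  shows "simple_sum (A ** B) = simple_sum A + simple_sum B"
  using assms unfolding borel_unitriangular_def forall_7 simple_sum_def
  by (simp add: borel_pos_def matrix_matrix_mult_def sum_7)

lemma root_elt_unitriangular:
  assumes "i \<in> {0, 1, 2, 3, 4, 5}"
  shows "borel_unitriangular (root_elt i r)"
  using assms unfolding borel_unitriangular_def forall_7
  by (elim insertE emptyE; hypsubst; simp add: root_elt_pos borel_pos_def
      x_a_def x_b_def x_ab_def x_2ab_def x_3ab_def x_3a2b_def E_def mat_def)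

lemma U_borel_unitriangular: "u \<in> U_borel \<Longrightarrow> borel_unitriangular u"
  unfolding root_group_eq
proof (induction rule: root_group_induct)
  case one
  then show ?case by (simp add: borel_unitriangular_def mat_def)
next
  case (mult i r v)
  then show ?case using root_elt_unitriangular borel_unitriangular_mult by blast
qed

lemma simple_sum_U_borel:
  "u \<in> U_borel \<Longrightarrow> v \<in> U_borel \<Longrightarrow> simple_sum (u ** v) = simple_sum u + simple_sum v"
  by (rule simple_sum_mult) (rule U_borel_unitriangular; assumption)+

lemma simple_sum_one: "simple_sum (mat 1) = 0"
  by (simp add: simple_sum_def mat_def)

lemma simple_sum_root_elt:
  "simple_sum (root_elt 0 r) = r" "simple_sum (root_elt 1 r) = 0" "simple_sum (root_elt 2 r) = 0"
  "simple_sum (root_elt 3 r) = 0" "simple_sum (root_elt 4 r) = 0" "simple_sum (root_elt 5 r) = r"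
  by (simp_all add: simple_sum_def root_elt_pos x_a_def x_b_def x_ab_def x_2ab_def x_3ab_def
      x_3a2b_def E_def mat_def)

lemma U_borel_inv: "u \<in> U_borel \<Longrightarrow> matrix_inv u \<in> U_borel"
  unfolding root_group_eq by (rule root_group_inv)

lemma U_borel_one: "mat 1 \<in> U_borel"
  unfolding root_group_eq by (rule root_group_one)

lemma U_borel_invertible: "u \<in> U_borel \<Longrightarrow> invertible u"
  unfolding root_group_eq by (rule root_group_invertible)

lemma simple_sum_inv: "u \<in> U_borel \<Longrightarrow> simple_sum (matrix_inv u) = - simple_sum u"
  using simple_sum_U_borel[of u "matrix_inv u"] U_borel_inv[of u]
    matrix_inv_mult(2)[OF U_borel_invertible, of u]
  by (simp add: simple_sum_one eq_neg_iff_add_eq_0 add.commute)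

text \<open>The anti-automorphism that fixes the elements of the simple root subgroups and inverts the
  torus.\<close>

definition sign_torus :: "'k::field^7^7" where
  "sign_torus = h_torus 1 (-1)"

definition anti :: "'k::field^7^7 \<Rightarrow> 'k^7^7" where
  "anti g = sign_torus ** matrix_inv g ** sign_torus"

lemma sign_torus_sq: "sign_torus ** sign_torus = mat 1"
  unfolding sign_torus_def h_torus_mult by (simp add: h_torus_1)

lemma sign_torus_cancel: "sign_torus ** (sign_torus ** A) = A"
  by (simp add: matrix_mul_assoc sign_torus_sq)

lemma matrix_inv_unique:
  assumes "A ** B = mat 1" "B ** A = mat 1"
  shows "matrix_inv A = B"
proof -
  have "invertible A" using assms unfolding invertible_def by blast
  then have "matrix_inv A = matrix_inv A ** (A ** B)" by (simp add: assms)
  also have "\<dots> = B" using matrix_inv_mult[OF \<open>invertible A\<close>] by (simp add: matrix_mul_assoc)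
  finally show ?thesis .
qed

lemma matrix_inv_mult_distrib:
  assumes "invertible A" "invertible B"
  shows "matrix_inv (A ** B) = matrix_inv B ** matrix_inv A"
proof (rule matrix_inv_unique)
  note a = matrix_inv_mult[OF assms(1)] matrix_inv_mult[OF assms(2)]
  show "A ** B ** (matrix_inv B ** matrix_inv A) = mat 1"
    by (simp add: matrix_mul_assoc[symmetric] mult_eq_assoc[OF a(4)] a)
  show "matrix_inv B ** matrix_inv A ** (A ** B) = mat 1"
    by (simp add: matrix_mul_assoc[symmetric] mult_eq_assoc[OF a(1)] a)
qed

lemma anti_mult:
  assumes "invertible A" "invertible B"
  shows "anti (A ** B) = anti B ** anti A"
  unfolding anti_def matrix_inv_mult_distrib[OF assms]
  by (simp add: matrix_mul_assoc[symmetric] sign_torus_cancel)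

lemma anti_anti:
  assumes "invertible A"
  shows "anti (anti A) = A"
proof -
  have "matrix_inv (anti A) = sign_torus ** A ** sign_torus"
    unfolding anti_def
    by (rule matrix_inv_unique)
      (simp_all add: matrix_mul_assoc[symmetric] sign_torus_cancel sign_torus_sq mult_eq_assoc[OF matrix_inv_mult(1)[OF assms]]
        mult_eq_assoc[OF matrix_inv_mult(2)[OF assms]])
  then show ?thesis unfolding anti_def[of "anti A"] by (simp add: matrix_mul_assoc[symmetric] sign_torus_cancel sign_torus_sq)
qed

lemma sign_torus_conj_root_group:
  assumes "u \<in> root_group I"
  shows "sign_torus ** u ** sign_torus \<in> root_group I"
proof -
  have "\<exists>v\<in>root_group I. sign_torus ** u = v ** sign_torus"
    by (rule root_group_normal[OF _ assms], rule bexI, unfold sign_torus_def, rule h_torus_conj)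
      (simp_all add: root_group_elt)
  then obtain v where "v \<in> root_group I" "sign_torus ** u = v ** sign_torus" by blast
  then show ?thesis by (simp add: matrix_mul_assoc[symmetric] sign_torus_sq)
qed

lemma anti_G2: "g \<in> G2 \<Longrightarrow> anti g \<in> G2"
  unfolding anti_def root_group_eq by (intro sign_torus_conj_root_group root_group_inv)

lemma anti_U_borel: "u \<in> U_borel \<Longrightarrow> anti u \<in> U_borel"
  unfolding anti_def root_group_eq by (intro sign_torus_conj_root_group root_group_inv)

lemma sign_torus_entry:
  fixes A :: "'k::field^7^7"
  shows "(sign_torus ** A ** sign_torus) $ i $ j = sign_torus $ i $ i * A $ i $ j * sign_torus $ j $ j"
proof -
  define d where "d a = (sign_torus :: 'k^7^7) $ a $ a" for a
  have sign_torus: "(sign_torus :: 'k^7^7) $ a $ b = (if a = b then d a else 0)" for a b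
    unfolding d_def using exhaust_7[of a] exhaust_7[of b] by (auto simp: sign_torus_def h_torus_def E_def)
  show ?thesis
    by (simp add: sign_torus matrix_matrix_mult_def if_distrib[of "\<lambda>x. x * _"] if_distrib[of "\<lambda>x. _ * x"] cong: if_cong)
qed

text \<open>Inversion negates the simple coordinates, and conjugation by \<open>sign_torus\<close>,
  where both simple roots are -1, negates them back.\<close>

lemma simple_sum_anti: "u \<in> U_borel \<Longrightarrow> simple_sum (anti u) = simple_sum u"
proof -
  assume u: "u \<in> U_borel"
  have "simple_sum (anti u) = - simple_sum (matrix_inv u)"
    unfolding anti_def simple_sum_def sign_torus_entry by (simp add: sign_torus_def h_torus_def E_def)
  then show ?thesis by (simp add: simple_sum_inv[OF u])
qed

text \<open>A form of the fixed-point condition that contains no inverse and can be checked by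
  applying matrices to a vector.\<close>

lemma anti_eq_self:
  assumes "n ** sign_torus ** n = sign_torus"
  shows "anti n = n"
proof -
  have "n ** (sign_torus ** n ** sign_torus) = mat 1" using assms by (simp add: matrix_mul_assoc sign_torus_sq)
  moreover have "(sign_torus ** n ** sign_torus) ** n = mat 1"
    using assms by (simp add: matrix_mul_assoc[symmetric] sign_torus_sq)
  ultimately have "matrix_inv n = sign_torus ** n ** sign_torus" by (rule matrix_inv_unique)
  then show ?thesis unfolding anti_def by (simp add: matrix_mul_assoc[symmetric] sign_torus_cancel sign_torus_sq)
qed

text \<open>Otherwise \<psi> would be trivial on all multiples of c - 1, that is on the whole
  field.\<close>

lemma character_eq_scale:
  assumes \<psi>: "nontrivial_additive_character \<psi>" and "\<And>r. \<psi> r = \<psi> (c * r)"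
  shows "c = 1"
proof (rule ccontr)
  assume c: "c \<noteq> 1"
  have add: "\<psi> (a + b) = \<psi> a * \<psi> b" "\<psi> 0 = 1" for a b
    using \<psi> by (auto simp: nontrivial_additive_character_def)
  have nz: "\<psi> a \<noteq> 0" for a using add(1)[of a "-a"] add(2) by auto
  have "\<psi> ((c - 1) * r) = 1" for r
  proof -
    have "\<psi> (c * r) = \<psi> ((c - 1) * r) * \<psi> r" unfolding add(1)[symmetric] by (simp add: algebra_simps)
    then show ?thesis using assms(2)[of r] nz[of r] by simp
  qed
  from this[of "_ / (c - 1)"] have "\<psi> r = 1" for r using c by simp
  then show False using \<psi> by (auto simp: nontrivial_additive_character_def)
qed

text \<open>The words of length 5 act on indices by 10 - i and by -i, so they fix \<beta> and
  \<alpha> respectively. The scale factor has to be known exactly, sign included, because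
  compatibility with \<psi> will force it to be 1.\<close>

lemma weyl_conj:
  "a \<noteq> 0 \<Longrightarrow> b \<noteq> 0 \<Longrightarrow> weyl_word True 5 ** h_torus a b ** root_elt 5 r =
     root_elt 5 (a / b * r) ** (weyl_word True 5 ** h_torus a b)"
  "a \<noteq> 0 \<Longrightarrow> b \<noteq> 0 \<Longrightarrow> weyl_word False 5 ** h_torus a b ** root_elt 0 r =
     root_elt 0 (b * r) ** (weyl_word False 5 ** h_torus a b)"
  by (intro matrix_eq_vec7; simp add: eval_nat_numeral simple_refl_def matrix_act field_simps)+

text \<open>The longest element inverts the torus, so the torus part cancels for all
  \<open>a\<close> and \<open>b\<close>. For the words of length 5 the torus parts are those allowed
  by \<open>weyl_conj\<close>: a/b = 1 and b = 1.\<close>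

lemma weyl_sign_torus:
  "a \<noteq> 0 \<Longrightarrow> b \<noteq> 0 \<Longrightarrow>
     weyl_word True 6 ** h_torus a b ** sign_torus ** (weyl_word True 6 ** h_torus a b) = sign_torus"
  "a \<noteq> 0 \<Longrightarrow> weyl_word True 5 ** h_torus a a ** sign_torus ** (weyl_word True 5 ** h_torus a a) = sign_torus"
  "a \<noteq> 0 \<Longrightarrow> weyl_word False 5 ** h_torus a 1 ** sign_torus ** (weyl_word False 5 ** h_torus a 1) = sign_torus"
  unfolding sign_torus_def
  by (intro matrix_eq_vec7; simp add: eval_nat_numeral simple_refl_def matrix_act field_simps)+

text \<open>If \<open>n\<close> sends a simple root to a positive non-simple root, then the characters disagree. This leaves
  only four of the twelve Weyl group elements.\<close>

lemma anti_weyl_torus: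
  assumes \<psi>: "nontrivial_additive_character \<psi>" and "n \<in> weyl_torus"
    and *: "\<And>u u'. u \<in> U_borel \<Longrightarrow> u' \<in> U_borel \<Longrightarrow> n ** u = u' ** n \<Longrightarrow>
      \<psi> (simple_sum u) = \<psi> (simple_sum u')"
  shows "anti n = n"
proof -
  obtain x k a b where n: "n = weyl_word x k ** h_torus a b" "k \<le> 6" "a \<noteq> 0" "b \<noteq> 0"
    using assms(2) unfolding weyl_torus_def by blast
  obtain c where c: "\<And>i r. n ** root_elt i r = root_elt ((-1)^k * i + weyl_shift x k) (c i * r) ** n"
    using acts_weyl_torus[OF n(3,4), of x k] unfolding acts_on_roots_def n(1) by metis
  have **: "\<psi> r = \<psi> (simple_sum (root_elt j t))"
    if "n ** root_elt i r = root_elt j t ** n" "i = 0 \<or> i = 5" "j mod 12 < 6" for i j r t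
    using *[OF U_borel_elt U_borel_elt that(1)] that(2,3) by (auto simp: simple_sum_root_elt)
  have nt: "((-1)^k * i + weyl_shift x k) mod 12 \<notin> {1, 2, 3, 4}" if i: "i = 0 \<or> i = 5" for i
  proof
    assume j: "((-1)^k * i + weyl_shift x k) mod 12 \<in> {1, 2, 3, 4}"
    define j' where "j' = ((-1)^k * i + weyl_shift x k) mod 12"
    have "\<psi> r = 1" for r
    proof -
      have "n ** root_elt i r = root_elt j' (c i * r) ** n" unfolding j'_def root_elt_mod by (rule c)
      from **[OF this i] j show ?thesis
        using \<psi> unfolding j'_def[symmetric] nontrivial_additive_character_def
        by (auto simp: simple_sum_root_elt)
    qed
    then show False using \<psi> by (auto simp: nontrivial_additive_character_def)
  qed
  have "k = 0 \<or> k = 1 \<or> k = 2 \<or> k = 3 \<or> k = 4 \<or> k = 5 \<or> k = 6" using n(2) by linarith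
  \<comment> \<open>For the lengths 1 to 4 the map on indices given by \<open>weyl_shift\<close>
    sends 0 or 5 into {1, 2, 3, 4}, which \<open>nt\<close> excludes.\<close>
  then consider "k = 0" | "k = 6" | "k = 5"
    using nt[of 0] nt[of 5] by (cases x) (auto simp: eval_nat_numeral)
  then show ?thesis
  proof cases
    case 1
    have "n = h_torus a b" using n 1 by simp
    then have "\<psi> r = \<psi> (b * r)" "\<psi> r = \<psi> (a * inverse b * r)" for r
      using **[OF h_torus_conj[OF n(3,4), of 0 r, folded \<open>n = h_torus a b\<close>]]
        **[OF h_torus_conj[OF n(3,4), of 5 r, folded \<open>n = h_torus a b\<close>]]
      by (simp_all add: root_char_def simple_sum_root_elt)
    then have "b = 1" "a * inverse b = 1" using character_eq_scale[OF \<psi>] by blast+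
    then have "n = mat 1" using \<open>n = h_torus a b\<close> by (simp add: h_torus_1)
    then show ?thesis by (intro anti_eq_self) simp
  next
    case 2
    then have "n = weyl_word True 6 ** h_torus a b" using n weyl_word_6 by metis
    then show ?thesis using weyl_sign_torus(1)[OF n(3,4)] by (intro anti_eq_self) simp
  next
    case 3
    show ?thesis
    proof (cases x)
      case True
      then have "n = weyl_word True 5 ** h_torus a b" using n 3 by simp
      then have "\<psi> r = \<psi> (a / b * r)" for r
        using **[OF weyl_conj(1)[OF n(3,4), of r, folded \<open>n = weyl_word True 5 ** h_torus a b\<close>]]
        by (simp add: simple_sum_root_elt)
      then have "a / b = 1" by (rule character_eq_scale[OF \<psi>])
      then have "b = a" using n(3,4) by (simp add: field_simps)
      then show ?thesis using weyl_sign_torus(2)[OF n(3)] \<open>n = weyl_word True 5 ** h_torus a b\<close>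
        by (intro anti_eq_self) simp
    next
      case False
      then have "n = weyl_word False 5 ** h_torus a b" using n 3 by simp
      then have "\<psi> r = \<psi> (b * r)" for r
        using **[OF weyl_conj(2)[OF n(3,4), of r, folded \<open>n = weyl_word False 5 ** h_torus a b\<close>]]
        by (simp add: simple_sum_root_elt)
      then have "b = 1" by (rule character_eq_scale[OF \<psi>])
      then show ?thesis using weyl_sign_torus(3)[OF n(3)] \<open>n = weyl_word False 5 ** h_torus a b\<close>
        by (intro anti_eq_self) simp
    qed
  qed
qed


section \<open>Weyl elements, positive root subgroups and U inside \<open>G2\<close>\<close>

lemma refl_a_G2: "refl_a \<in> G2"
proof -
  have r: "refl_a = root_elt 0 1 ** root_elt 6 (-1) ** root_elt 0 (1::'a)"
    by (intro matrix_eq_vec7) (simp add: matrix_act)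
  show "refl_a \<in> (G2 :: ('a^7^7) set)"
    unfolding root_group_eq r by (intro root_group_mult root_group_elt) simp_all
qed

lemma refl_b_G2: "refl_b \<in> G2"
proof -
  have r: "refl_b = root_elt 5 1 ** root_elt 11 (-1) ** root_elt 5 (1::'a)"
    by (intro matrix_eq_vec7) (simp add: matrix_act)
  show "refl_b \<in> (G2 :: ('a^7^7) set)"
    unfolding root_group_eq r by (intro root_group_mult root_group_elt) simp_all
qed

lemma G2_mult: "g \<in> G2 \<Longrightarrow> h \<in> G2 \<Longrightarrow> g ** h \<in> G2"
  unfolding root_group_eq by (rule root_group_mult)

lemma G2_inv: "g \<in> G2 \<Longrightarrow> matrix_inv g \<in> G2"
  unfolding root_group_eq by (rule root_group_inv)

lemma G2_invertible: "g \<in> G2 \<Longrightarrow> invertible g"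
  unfolding root_group_eq by (rule root_group_invertible)

lemma G2_one: "mat 1 \<in> G2"
  unfolding root_group_eq by (rule root_group_one)

text \<open>\<open>G2\<close> is generated by the simple roots and their negatives only. The
  reflections carry the short root 0 to 4 and then 2, and the long root 5 to 1 and then 3.\<close>

lemma root_elt_G2:
  assumes "i \<in> {0, 1, 2, 3, 4, 5, 6, 11}"
  shows "root_elt i r \<in> G2"
proof -
  have conj: "y \<in> G2" if "n ** x = y ** n" "n \<in> G2" "x \<in> G2" for n x y :: "'a^7^7"
  proof -
    have "y = n ** x ** matrix_inv n"
      unfolding that(1) by (simp add: matrix_mul_assoc[symmetric] matrix_inv_mult[OF G2_invertible[OF that(2)]])
    then show ?thesis using that(2,3) by (simp add: G2_mult G2_inv)
  qed
  have gens: "root_elt 0 r \<in> G2" "root_elt 5 r \<in> G2" "root_elt 6 r \<in> G2" "root_elt 11 r \<in> G2" for r :: 'a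
    unfolding root_group_eq by (simp_all add: root_group_elt)
  have 1: "root_elt 1 r \<in> G2" for r :: 'a
    using conj[OF refl_a_conj[of 5] refl_a_G2 gens(2)] by simp
  have 4: "root_elt 4 r \<in> G2" for r :: 'a
    using conj[OF refl_b_conj[of 0] refl_b_G2 gens(1)] by simp
  have 2: "root_elt 2 r \<in> G2" for r :: 'a
    using conj[OF refl_a_conj[of 4] refl_a_G2 4] by simp
  have 3: "root_elt 3 r \<in> G2" for r :: 'a
    using conj[OF refl_b_conj[of 1] refl_b_G2 1] by simp
  show ?thesis using assms gens 1 2 3 4 by auto
qed

lemma U_borel_G2: "u \<in> U_borel \<Longrightarrow> u \<in> G2"
  unfolding root_group_eq(3)
  by (induction rule: root_group_induct) (auto intro!: G2_one G2_mult root_elt_G2)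

lemma bij_U_borel:
  assumes "u \<in> U_borel"
  shows "bij_betw (\<lambda>v. u ** v) U_borel U_borel" "bij_betw (\<lambda>v. v ** u) U_borel U_borel"
proof -
  note inv = matrix_inv_mult[OF U_borel_invertible[OF assms]]
  show "bij_betw (\<lambda>v. u ** v) U_borel U_borel"
    by (rule bij_betw_byWitness[of _ "\<lambda>v. matrix_inv u ** v"])
      (auto simp: matrix_mul_assoc inv intro: U_borel_mult U_borel_inv assms)
  show "bij_betw (\<lambda>v. v ** u) U_borel U_borel"
    by (rule bij_betw_byWitness[of _ "\<lambda>v. v ** matrix_inv u"])
      (auto simp: matrix_mul_assoc[symmetric] inv intro: U_borel_mult U_borel_inv assms)
qed

lemma bij_anti: "bij_betw anti U_borel U_borel"
  by (rule bij_betw_byWitness[of _ anti])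
    (auto simp: anti_anti U_borel_invertible anti_U_borel)


section \<open>Uniqueness of Whittaker models\<close>

text \<open>A polynomial p with p(A) w = 0 comes from the dependent sequence w, A w, ...; splitting
  off its roots one by one meets an eigenvector. All vectors involved stay in the invariant subspace
  S.\<close>

lemma eigenvector_exists:
  fixes s :: "complex \<Rightarrow> 'v::ab_group_add \<Rightarrow> 'v"
  assumes fd: "finite_dimensional_vector_space s B" and lin: "Vector_Spaces.linear s s A"
    and S: "module.subspace s S" "A ` S \<subseteq> S" and w: "w \<in> S" "w \<noteq> 0"
  shows "\<exists>v\<in>S. v \<noteq> 0 \<and> (\<exists>c. A v = s c v)"
proof -
  interpret finite_dimensional_vector_space s B by fact
  interpret A: Vector_Spaces.linear s s A by fact
  \<comment> \<open>This is p(A) w cut off after N terms; it is the full value only if the degree of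
    p is below N.\<close>
  define ev where "ev N p = (\<Sum>i<N. s (coeff p i) ((A^^i) w))" for N and p :: "complex poly"
  have pow: "(A^^i) w \<in> S" for i by (induction i) (use S w in auto)
  have ev_S: "ev N p \<in> S" for N p
    unfolding ev_def by (intro subspace_sum subspace_scale S pow)
  have shift: "ev (Suc N) ([:- z, 1:] * q) = A (ev N q) - s z (ev N q)" if "degree q < N" for N z q
  proof -
    have "coeff q N = 0" using that by (simp add: coeff_eq_0)
    then have "ev (Suc N) (smult z q) = s z (ev N q)"
      by (simp add: ev_def scale_sum_right)
    moreover have "ev (Suc N) (pCons 0 q) = A (ev N q)"
      unfolding ev_def sum.lessThan_Suc_shift by (simp add: A.sum A.scale)
    moreover have "ev (Suc N) ([:- z, 1:] * q) = ev (Suc N) (pCons 0 q) - ev (Suc N) (smult z q)"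
      by (simp add: ev_def sum_subtractf scale_left_diff_distrib)
    ultimately show ?thesis by simp
  qed
  \<comment> \<open>With p = (X - z) q, either q(A) w vanishes and the degree drops, or q(A) w is an
    eigenvector for z.\<close>
  have main: "\<exists>v\<in>S. v \<noteq> 0 \<and> (\<exists>c. A v = s c v)" if "p \<noteq> 0" "ev (Suc (degree p)) p = 0" for p
    using that
  proof (induction "degree p" arbitrary: p)
    case 0
    then obtain c where "p = [:c:]" by (metis degree_eq_zeroE)
    then have "s c w = 0" "c \<noteq> 0" using 0 by (auto simp: ev_def)
    then show ?case using w by simp
  next
    case (Suc n)
    then have "\<not> constant (poly p)" by (simp add: constant_degree)
    then obtain z where "poly p z = 0" using fundamental_theorem_of_algebra by blast
    then obtain q where q: "p = [:- z, 1:] * q" by (metis poly_eq_0_iff_dvd dvdE)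
    have "q \<noteq> 0" using q Suc.prems by auto
    then have deg: "degree p = Suc (degree q)" unfolding q by (subst degree_mult_eq) auto
    have "A (ev (Suc (degree q)) q) - s z (ev (Suc (degree q)) q) = 0"
      using shift[of q "Suc (degree q)" z] Suc.prems(2) unfolding deg q[symmetric] by simp
    then show ?case
    proof (cases "ev (Suc (degree q)) q = 0")
      case True
      then show ?thesis using Suc.hyps(1)[of q] \<open>q \<noteq> 0\<close> Suc.hyps(2) deg by simp
    next
      case False
      then show ?thesis
        using \<open>A (ev (Suc (degree q)) q) - s z (ev (Suc (degree q)) q) = 0\<close> ev_S by auto
    qed
  qed
  define n where "n = card B"
  \<comment> \<open>One vector more than the dimension gives a relation. \<open>dependent\<close>
    concerns sets, so a repetition in the sequence is treated apart, with coefficients 1 and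
    -1.\<close>
  obtain c where c: "(\<Sum>i\<le>n. s (c i) ((A^^i) w)) = 0" "\<exists>i\<le>n. c i \<noteq> 0"
  proof (cases "inj_on (\<lambda>i. (A^^i) w) {..n}")
    case True
    then have "card ((\<lambda>i. (A^^i) w) ` {..n}) = Suc n" by (simp add: card_image)
    then have "dependent ((\<lambda>i. (A^^i) w) ` {..n})"
      using independent_card_le_dim[of "(\<lambda>i. (A^^i) w) ` {..n}" UNIV] dim_UNIV unfolding n_def by auto
    then obtain u where u: "\<exists>v\<in>(\<lambda>i. (A^^i) w) ` {..n}. u v \<noteq> 0" "(\<Sum>v\<in>(\<lambda>i. (A^^i) w) ` {..n}. s (u v) v) = 0"
      by (subst (asm) dependent_finite) auto
    have "(\<Sum>i\<le>n. s (u ((A^^i) w)) ((A^^i) w)) = 0"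
      using u(2) by (simp add: sum.reindex[OF True])
    then show thesis using that[of "\<lambda>i. u ((A^^i) w)"] u(1) by auto
  next
    case False
    then obtain i j where ij: "i \<le> n" "j \<le> n" "i \<noteq> j" "(A^^i) w = (A^^j) w" by (auto simp: inj_on_def)
    have "(\<Sum>l\<le>n. s ((if l = i then 1 else 0) - (if l = j then 1 else 0)) ((A^^l) w)) =
        (\<Sum>l\<le>n. if l = i then (A^^l) w else 0) - (\<Sum>l\<le>n. if l = j then (A^^l) w else 0)"
      by (simp add: sum_subtractf scale_left_diff_distrib if_distrib[of "\<lambda>x. s x _"] cong: if_cong)
    also have "\<dots> = 0" using ij by (simp add: sum.delta)
    finally show thesis
      using that[of "\<lambda>l. (if l = i then 1 else 0) - (if l = j then 1 else 0)"] ij(1,3)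
      by (force intro: exI[of _ i])
  qed
  define p where "p = (\<Sum>i\<le>n. monom (c i) i)"
  have coeff: "coeff p i = (if i \<le> n then c i else 0)" for i
    unfolding p_def coeff_sum by (simp add: sum.delta)
  have "p \<noteq> 0" using c(2) coeff by (metis coeff_0)
  have "degree p \<le> n" by (rule degree_le) (simp add: coeff)
  have "ev (Suc (degree p)) p = (\<Sum>i\<le>n. s (coeff p i) ((A^^i) w))"
    unfolding ev_def lessThan_Suc_atMost
    by (rule sum.mono_neutral_left) (use \<open>degree p \<le> n\<close> in \<open>auto simp: coeff_eq_0\<close>)
  also have "\<dots> = 0" using c(1) by (simp add: coeff)
  finally show ?thesis using main[OF \<open>p \<noteq> 0\<close>] by blast
qed

locale whittaker =
  fixes s :: "complex \<Rightarrow> 'v::ab_group_add \<Rightarrow> 'v"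
    and \<pi> :: "'k::{field,finite}^7^7 \<Rightarrow> 'v \<Rightarrow> 'v"
    and \<psi> :: "'k \<Rightarrow> complex"
  assumes irreducible: "irreducible_rep s G2 \<pi>"
    and psi: "nontrivial_additive_character \<psi>"
begin

lemma representation: "is_representation s G2 \<pi>"
  using irreducible by (simp add: irreducible_rep_def)

sublocale vector_space s
  using representation unfolding is_representation_def finite_dimensional_vector_space_def by blast

lemma pi_linear: "g \<in> G2 \<Longrightarrow> Vector_Spaces.linear s s (\<pi> g)"
  using representation by (simp add: is_representation_def)

lemma pi_hom:
  assumes "g \<in> G2"
  shows "\<pi> g (v + w) = \<pi> g v + \<pi> g w" "\<pi> g (s c v) = s c (\<pi> g v)"
    "\<pi> g (sum f X) = (\<Sum>x\<in>X. \<pi> g (f x))"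
proof -
  interpret L: Vector_Spaces.linear s s "\<pi> g" by (rule pi_linear[OF assms])
  show "\<pi> g (v + w) = \<pi> g v + \<pi> g w" "\<pi> g (s c v) = s c (\<pi> g v)"
    "\<pi> g (sum f X) = (\<Sum>x\<in>X. \<pi> g (f x))"
    by (rule L.add L.scale L.sum)+
qed

lemma pi_one: "\<pi> (mat 1) v = v"
  using representation by (simp add: is_representation_def)

lemma pi_mult: "g \<in> G2 \<Longrightarrow> h \<in> G2 \<Longrightarrow> \<pi> (g ** h) v = \<pi> g (\<pi> h v)"
  using representation by (simp add: is_representation_def)

lemma psi_add: "\<psi> (a + b) = \<psi> a * \<psi> b" and psi_0: "\<psi> 0 = 1"
  using psi by (auto simp: nontrivial_additive_character_def)

lemma psi_minus: "\<psi> (- a) * \<psi> a = 1" "\<psi> a * \<psi> (- a) = 1"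
  unfolding psi_add[symmetric] by (simp_all add: psi_0)

definition theta :: "'k^7^7 \<Rightarrow> complex" where
  "theta u = \<psi> (simple_sum u)"

text \<open>The projector onto the vectors on which U acts by \<open>theta\<close>, multiplied by
  the order of U.\<close>

definition whit :: "'v \<Rightarrow> 'v" where
  "whit v = (\<Sum>u\<in>U_borel. s (\<psi> (- simple_sum u)) (\<pi> u v))"

lemma theta_anti: "u \<in> U_borel \<Longrightarrow> theta (anti u) = theta u"
  unfolding theta_def by (simp add: simple_sum_anti)

lemma whit_right:
  assumes "u \<in> U_borel"
  shows "whit (\<pi> u v) = s (theta u) (whit v)"
proof -
  have "s (theta u) (whit v) = (\<Sum>w\<in>U_borel. s (theta u * \<psi> (- simple_sum w)) (\<pi> w v))"
    by (simp add: whit_def scale_sum_right)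
  also have "\<dots> = (\<Sum>w\<in>U_borel. s (theta u * \<psi> (- simple_sum (w ** u))) (\<pi> (w ** u) v))"
    by (rule sum.reindex_bij_betw[OF bij_U_borel(2)[OF assms], symmetric])
  also have "\<dots> = (\<Sum>w\<in>U_borel. s (\<psi> (- simple_sum w)) (\<pi> w (\<pi> u v)))"
  proof (rule sum.cong)
    fix w :: "'k^7^7"
    assume w: "w \<in> U_borel"
    have "theta u * \<psi> (- simple_sum (w ** u)) = \<psi> (- simple_sum w)"
      unfolding theta_def psi_add[symmetric] by (simp add: simple_sum_U_borel[OF w assms])
    then show "s (theta u * \<psi> (- simple_sum (w ** u))) (\<pi> (w ** u) v) =
        s (\<psi> (- simple_sum w)) (\<pi> w (\<pi> u v))"
      using w assms by (simp add: pi_mult U_borel_G2)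
  qed simp
  finally show ?thesis by (simp add: whit_def)
qed

lemma whit_left:
  assumes "u \<in> U_borel"
  shows "\<pi> u (whit v) = s (theta u) (whit v)"
proof -
  have "s (theta u) (whit v) = (\<Sum>w\<in>U_borel. s (theta u * \<psi> (- simple_sum w)) (\<pi> w v))"
    by (simp add: whit_def scale_sum_right)
  also have "\<dots> = (\<Sum>w\<in>U_borel. s (theta u * \<psi> (- simple_sum (u ** w))) (\<pi> (u ** w) v))"
    by (rule sum.reindex_bij_betw[OF bij_U_borel(1)[OF assms], symmetric])
  also have "\<dots> = (\<Sum>w\<in>U_borel. s (\<psi> (- simple_sum w)) (\<pi> u (\<pi> w v)))"
  proof (rule sum.cong)
    fix w :: "'k^7^7"
    assume w: "w \<in> U_borel"
    have "theta u * \<psi> (- simple_sum (u ** w)) = \<psi> (- simple_sum w)"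
      unfolding theta_def psi_add[symmetric] by (simp add: simple_sum_U_borel[OF assms w])
    then show "s (theta u * \<psi> (- simple_sum (u ** w))) (\<pi> (u ** w) v) =
        s (\<psi> (- simple_sum w)) (\<pi> u (\<pi> w v))"
      using w assms by (simp add: pi_mult U_borel_G2)
  qed simp
  finally show ?thesis by (simp add: whit_def pi_hom U_borel_G2[OF assms])
qed

lemma whit_hom:
  "whit (v + w) = whit v + whit w" "whit (s c v) = s c (whit v)" "whit (sum f X) = (\<Sum>x\<in>X. whit (f x))"
proof -
  show add: "whit (v + w) = whit v + whit w" for v w
    by (simp add: whit_def pi_hom U_borel_G2 scale_right_distrib sum.distrib)
  show scale: "whit (s c v) = s c (whit v)" for c v
    by (simp add: whit_def pi_hom U_borel_G2 scale_sum_right mult.commute)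
  have "whit 0 = 0" using scale[of 0 0] by simp
  then show "whit (sum f X) = (\<Sum>x\<in>X. whit (f x))"
    by (induction X rule: infinite_finite_induct) (simp_all add: add)
qed

lemma whit_whit: "whit (whit v) = s (of_nat (card (U_borel :: ('k^7^7) set))) (whit v)"
proof -
  have "whit (whit v) = (\<Sum>u\<in>(U_borel :: ('k^7^7) set). whit v)"
    unfolding whit_def[of "whit v"] by (rule sum.cong) (simp_all add: whit_left theta_def psi_minus)
  then show ?thesis
    by (simp add: scale_sum_left[of "\<lambda>_. 1" U_borel "whit v", simplified])
qed

lemma card_U_borel: "of_nat (card (U_borel :: ('k^7^7) set)) \<noteq> (0 :: complex)"
  using U_borel_one by (simp add: card_eq_0_iff) blast

text \<open>The operator of g in the Hecke algebra of \<open>theta\<close>, up to a scalar, extended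
  from the range of \<open>whit\<close> to the whole space.\<close>

definition hecke :: "'k^7^7 \<Rightarrow> 'v \<Rightarrow> 'v" where
  "hecke g v = whit (\<pi> g (whit v))"

lemma hecke_left: "u \<in> U_borel \<Longrightarrow> g \<in> G2 \<Longrightarrow> hecke (u ** g) v = s (theta u) (hecke g v)"
  unfolding hecke_def by (simp add: pi_mult U_borel_G2 whit_right)

lemma hecke_right: "u \<in> U_borel \<Longrightarrow> g \<in> G2 \<Longrightarrow> hecke (g ** u) v = s (theta u) (hecke g v)"
  unfolding hecke_def by (simp add: pi_mult U_borel_G2 whit_left pi_hom whit_hom)

text \<open>The vector v only witnesses that the operator is nonzero. If n x = y n, moving x and y
  out of the operator at v gives \<open>theta x = theta y\<close>; hence the Weyl part n of g is
  fixed by \<open>anti\<close>, and the U-parts contribute the same scalars in either order.\<close>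

lemma hecke_anti_if_nonzero:
  assumes g: "g \<in> G2" and nz: "hecke g v \<noteq> 0"
  shows "hecke (anti g) w = hecke g w"
proof -
  obtain u n u' where d: "g = u ** n ** u'" "u \<in> U_borel" "n \<in> weyl_torus" "u' \<in> U_borel"
    using g bruhat_decomposition unfolding bruhat_set_def by blast
  have "n = matrix_inv u ** g ** matrix_inv u'"
    unfolding d(1) by (simp add: matrix_mul_assoc[symmetric] matrix_inv_mult[OF U_borel_invertible[OF d(4)]])
      (simp add: matrix_mul_assoc matrix_inv_mult[OF U_borel_invertible[OF d(2)]])
  then have n: "n \<in> G2" using g d(2,4) by (simp add: G2_mult G2_inv U_borel_G2)
  have hecke_g: "hecke g w = s (theta u) (s (theta u') (hecke n w))" for w
    using d n by (simp add: matrix_mul_assoc[symmetric] hecke_left hecke_right G2_mult U_borel_G2)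
  have "hecke n v \<noteq> 0" using nz hecke_g by auto
  have anti: "anti n = n"
  proof (rule anti_weyl_torus[OF psi d(3)])
    fix x y :: "'k^7^7"
    assume xy: "x \<in> U_borel" "y \<in> U_borel" "n ** x = y ** n"
    have "s (theta x) (hecke n v) = s (theta y) (hecke n v)"
      using hecke_right[OF xy(1) n, of v] hecke_left[OF xy(2) n, of v] xy(3) by auto
    then show "\<psi> (simple_sum x) = \<psi> (simple_sum y)"
      using \<open>hecke n v \<noteq> 0\<close> by (auto simp: theta_def)
  qed
  have "anti g = anti u' ** n ** anti u"
    unfolding d(1) using anti_mult[OF invertible_mult[OF U_borel_invertible[OF d(2)] G2_invertible[OF n]]
        U_borel_invertible[OF d(4)]] anti_mult[OF U_borel_invertible[OF d(2)] G2_invertible[OF n]]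
    by (simp add: anti matrix_mul_assoc)
  then have "hecke (anti g) w = s (theta u') (s (theta u) (hecke n w))"
    using d n by (simp add: matrix_mul_assoc[symmetric] hecke_left hecke_right G2_mult U_borel_G2
        anti_U_borel theta_anti)
  then show ?thesis unfolding hecke_g by (rule trans) (rule scale_left_commute)
qed

lemma hecke_anti:
  assumes "g \<in> G2"
  shows "hecke (anti g) v = hecke g v"
proof (cases "hecke g v = 0 \<and> hecke (anti g) v = 0")
  \<comment> \<open>If only the value at \<open>anti g\<close> is nonzero, the preceding lemma is
    applied to \<open>anti g\<close>, whose image under \<open>anti\<close> is g.\<close>
  case False
  then show ?thesis
    using hecke_anti_if_nonzero[OF assms, of v v] hecke_anti_if_nonzero[OF anti_G2[OF assms], of v v]
      anti_anti[OF G2_invertible[OF assms]] by metis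
qed simp

lemma hecke_mult:
  assumes "g \<in> G2" "h \<in> G2"
  shows "hecke g (hecke h v) = s (of_nat (card (U_borel :: ('k^7^7) set)))
    (\<Sum>u\<in>U_borel. s (\<psi> (- simple_sum u)) (hecke (g ** u ** h) v))"
proof -
  have "hecke g (hecke h v) = s (of_nat (card (U_borel :: ('k^7^7) set))) (whit (\<pi> g (whit (\<pi> h (whit v)))))"
    unfolding hecke_def whit_whit by (simp add: whit_hom pi_hom assms)
  also have "whit (\<pi> g (whit (\<pi> h (whit v)))) =
      (\<Sum>u\<in>U_borel. s (\<psi> (- simple_sum u)) (hecke (g ** u ** h) v))"
    unfolding whit_def[of "\<pi> h (whit v)"] hecke_def
    by (simp add: pi_hom whit_hom assms pi_mult G2_mult U_borel_G2)
  finally show ?thesis .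
qed

text \<open>Gelfand's trick: applying \<open>anti\<close> to every term of the product formula
  reverses the factors, while each Hecke operator is unchanged.\<close>

lemma hecke_commute:
  assumes "g \<in> G2" "h \<in> G2"
  shows "hecke g (hecke h v) = hecke h (hecke g v)"
proof -
  have "(\<Sum>u\<in>U_borel. s (\<psi> (- simple_sum u)) (hecke (g ** u ** h) v)) =
      (\<Sum>u\<in>U_borel. s (\<psi> (- simple_sum (anti u))) (hecke (anti h ** anti u ** anti g) v))"
  proof (rule sum.cong)
    fix u :: "'k^7^7"
    assume u: "u \<in> U_borel"
    have "anti (g ** u ** h) = anti h ** anti u ** anti g"
      using assms u by (simp add: anti_mult invertible_mult G2_invertible U_borel_invertible matrix_mul_assoc)
    then show "s (\<psi> (- simple_sum u)) (hecke (g ** u ** h) v) =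
        s (\<psi> (- simple_sum (anti u))) (hecke (anti h ** anti u ** anti g) v)"
      using hecke_anti[of "g ** u ** h" v] assms u
      by (simp add: G2_mult U_borel_G2 simple_sum_anti)
  qed simp
  also have "\<dots> = (\<Sum>u\<in>U_borel. s (\<psi> (- simple_sum u)) (hecke (anti h ** u ** anti g) v))"
    by (rule sum.reindex_bij_betw[OF bij_anti])
  finally have "hecke g (hecke h v) = hecke (anti h) (hecke (anti g) v)"
    using assms by (simp add: hecke_mult anti_G2)
  then show ?thesis using assms by (simp add: hecke_anti)
qed

lemma orbit_span:
  assumes "w \<noteq> 0"
  shows "span ((\<lambda>g. \<pi> g w) ` G2) = UNIV"
proof -
  let ?W = "span ((\<lambda>g. \<pi> g w) ` G2)"
  have "\<pi> g ` ?W \<subseteq> ?W" if g: "g \<in> G2" for g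
  proof -
    interpret L: Vector_Spaces.linear s s "\<pi> g" by (rule pi_linear[OF g])
    have "\<pi> g ` ?W = span (\<pi> g ` (\<lambda>g. \<pi> g w) ` G2)" by (rule L.span_image[symmetric])
    also have "\<dots> \<subseteq> ?W"
      by (rule span_mono) (use g in \<open>auto simp: pi_mult[symmetric] intro!: imageI G2_mult\<close>)
    finally show ?thesis .
  qed
  then have "?W = {0} \<or> ?W = UNIV"
    using irreducible unfolding irreducible_rep_def by blast
  moreover have "w \<in> ?W" by (rule span_base) (use pi_one G2_one in \<open>metis imageI\<close>)
  ultimately show ?thesis using assms by auto
qed

lemma hecke_add_scale:
  assumes "g \<in> G2"
  shows "hecke g (v + w) = hecke g v + hecke g w" "hecke g (s c v) = s c (hecke g v)"
  by (simp_all add: hecke_def whit_hom pi_hom assms)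

lemma subspace_whit: "subspace (range whit)"
  unfolding subspace_def
proof (intro conjI ballI allI)
  show "0 \<in> range whit" using whit_hom(2)[of 0 0] by (intro image_eqI[of _ _ "s 0 0"]) simp_all
  show "x + y \<in> range whit" if "x \<in> range whit" "y \<in> range whit" for x y
    using that by (auto simp: whit_hom(1)[symmetric])
  show "s c x \<in> range whit" if "x \<in> range whit" for c x
    using that by (auto simp: whit_hom(2)[symmetric])
qed

text \<open>Irreducibility passes to the range of \<open>whit\<close>: the translates of w span
  everything, and \<open>whit\<close> maps the translate by g to a multiple of
  \<open>hecke g w\<close>. So every nonzero vector of the range is cyclic for the Hecke
  operators.\<close>

lemma whit_in_subspace:
  assumes w: "w = whit w'" "w \<noteq> 0" and S: "subspace S" "\<And>g. g \<in> G2 \<Longrightarrow> hecke g w \<in> S"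
  shows "whit v \<in> S"
proof -
  let ?q = "of_nat (card (U_borel :: ('k^7^7) set)) :: complex"
  have "v \<in> span ((\<lambda>g. \<pi> g w) ` G2)" using orbit_span[OF w(2)] by simp
  then show ?thesis
  proof (induction rule: span_induct_alt)
    case base
    show ?case using whit_hom(2)[of 0 0] subspace_0[OF S(1)] by simp
  next
    case (step c x y)
    obtain g where g: "g \<in> G2" "x = \<pi> g w" using step(1) by blast
    have "hecke g w = s ?q (whit x)"
      unfolding hecke_def g(2) w(1) whit_whit by (simp add: pi_hom g(1) whit_hom)
    then have "whit x = s (inverse ?q) (hecke g w)" using card_U_borel by simp
    then show ?case using S g(1) step(2) by (simp add: whit_hom subspace_add subspace_scale)
  qed
qed

text \<open>Schur's lemma for a commuting family: an eigenspace of \<open>hecke g\<close> is stable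
  under all Hecke operators, so it contains the range of \<open>whit\<close>.\<close>

lemma hecke_scalar:
  assumes g: "g \<in> G2"
  shows "\<exists>c. \<forall>v. hecke g (whit v) = s c (whit v)"
proof (cases "\<forall>v. whit v = 0")
  case True
  then show ?thesis by (simp add: hecke_def)
next
  case False
  then obtain w0 where "whit w0 \<noteq> 0" by blast
  obtain B where B: "finite_dimensional_vector_space s B"
    using representation by (auto simp: is_representation_def)
  have lin: "Vector_Spaces.linear s s (hecke g)"
    by unfold_locales (simp_all add: hecke_add_scale g)
  have "\<exists>v\<in>range whit. v \<noteq> 0 \<and> (\<exists>c. hecke g v = s c v)"
    by (rule eigenvector_exists[OF B lin subspace_whit, of "whit w0"])
      (use \<open>whit w0 \<noteq> 0\<close> in \<open>auto simp: hecke_def\<close>)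
  then obtain w c where w: "whit w \<noteq> 0" "hecke g (whit w) = s c (whit w)" by blast
  let ?S = "{v. hecke g v = s c v}"
  have "subspace ?S"
    unfolding subspace_def using hecke_add_scale[OF g] hecke_add_scale(2)[OF g, of 0 0]
    by (auto simp: scale_right_distrib scale_left_commute)
  have "hecke h (whit w) \<in> ?S" if "h \<in> G2" for h
    by (simp add: hecke_commute[OF g that] w(2) hecke_add_scale[OF that])
  then have "whit v \<in> ?S" for v
    using whit_in_subspace[of "whit w" w ?S] w(1) \<open>subspace ?S\<close> by blast
  then show ?thesis by blast
qed

text \<open>Since all Hecke operators act by scalars, the line through one nonzero
  \<open>whit w\<close> is stable and hence is the whole range.\<close>

theorem whittaker_unique: "\<exists>w. \<forall>v. \<exists>c. whit v = s c w"
proof (cases "\<forall>v. whit v = 0")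
  case True
  then show ?thesis by (metis scale_zero_left)
next
  case False
  then obtain w where w: "whit w \<noteq> 0" by blast
  have "whit v \<in> span {whit w}" for v
  proof (rule whit_in_subspace[OF HOL.refl w])
    show "hecke g (whit w) \<in> span {whit w}" if "g \<in> G2" for g
      using hecke_scalar[OF that] by (metis insertI1 span_base span_scale)
  qed simp
  then show ?thesis unfolding span_singleton by blast
qed

end


section \<open>Root exchange and Fourier expansion\<close>

lemma sum_shift:
  fixes f :: "'k::{ab_group_add,finite} \<Rightarrow> 'b::comm_monoid_add"
  shows "(\<Sum>t\<in>UNIV. f (t + a)) = (\<Sum>t\<in>UNIV. f t)"
  by (rule sum.reindex_bij_betw, rule bij_betw_byWitness[of _ "\<lambda>t. t - a"]) auto

lemma sum_scale:
  fixes f :: "'k::{field,finite} \<Rightarrow> 'b::comm_monoid_add"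
  assumes "c \<noteq> 0"
  shows "(\<Sum>t\<in>UNIV. f (c * t)) = (\<Sum>t\<in>UNIV. f t)"
  by (rule sum.reindex_bij_betw, rule bij_betw_byWitness[of _ "\<lambda>t. t / c"]) (use assms in auto)

text \<open>The Coxeter element is the rotation by 60 degrees, i to i + 2. It also carries
  \<open>h_torus c 1\<close>, the kernel of \<alpha> in the torus, to the diagonal torus of
  SL_2.\<close>

lemma coxeter_conj:
  "refl_a ** refl_b ** root_elt 0 r = root_elt 2 r ** (refl_a ** refl_b)"
  "refl_a ** refl_b ** root_elt 1 r = root_elt 3 r ** (refl_a ** refl_b)"
  "refl_a ** refl_b ** root_elt 2 r = root_elt 4 (- r) ** (refl_a ** refl_b)"
  "refl_a ** refl_b ** root_elt 3 r = root_elt 5 r ** (refl_a ** refl_b)"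
  "refl_a ** refl_b ** root_elt 11 r = root_elt 1 (- r) ** (refl_a ** refl_b)"
  "c \<noteq> 0 \<Longrightarrow> refl_a ** refl_b ** h_torus c 1 = h_torus c (inverse c) ** (refl_a ** refl_b)"
  by (intro matrix_eq_vec7; simp add: matrix_act algebra_simps)+

lemma h_torus_G2:
  assumes "c \<noteq> 0"
  shows "h_torus c (inverse c) \<in> G2" "h_torus c 1 \<in> G2"
proof -
  have "h_torus c (inverse c) ** refl_b = root_elt 5 c ** root_elt 11 (- inverse c) ** root_elt 5 c"
    using assms by (intro matrix_eq_vec7) (simp add: matrix_act field_simps)
  also have "\<dots> \<in> G2" by (intro G2_mult root_elt_G2) simp_all
  finally have "h_torus c (inverse c) ** refl_b ** matrix_inv refl_b \<in> G2"
    by (rule G2_mult) (rule G2_inv[OF refl_b_G2])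
  then show 1: "h_torus c (inverse c) \<in> G2"
    by (simp add: matrix_mul_assoc[symmetric] matrix_inv_mult[OF G2_invertible[OF refl_b_G2]])
  let ?w = "refl_a ** refl_b :: 'a^7^7"
  have w: "?w \<in> G2" by (intro G2_mult refl_a_G2 refl_b_G2)
  have "matrix_inv ?w ** (?w ** h_torus c 1) \<in> G2"
    unfolding coxeter_conj(6)[OF assms] by (intro G2_mult G2_inv refl_a_G2 refl_b_G2 1)
  then show "h_torus c 1 \<in> G2"
    by (simp only: mult_eq_assoc[OF matrix_inv_mult(1)[OF G2_invertible[OF w]]] matrix_mul_lid)
qed

locale cuspidal = whittaker s \<pi> \<psi>
  for s :: "complex \<Rightarrow> 'v::ab_group_add \<Rightarrow> 'v"
    and \<pi> :: "'k::{field,finite}^7^7 \<Rightarrow> 'v \<Rightarrow> 'v"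
    and \<psi> :: "'k \<Rightarrow> complex" +
  assumes cuspidal: "cuspidal_G2 \<pi>"
begin

definition functional :: "('v \<Rightarrow> complex) \<Rightarrow> bool" where
  "functional f \<longleftrightarrow> (\<forall>v w. f (v + w) = f v + f w) \<and> (\<forall>c v. f (s c v) = c * f v)"

lemma functional_sum:
  assumes "functional f"
  shows "f (sum g X) = (\<Sum>x\<in>X. f (g x))"
proof -
  have "f (s 0 0) = 0" using assms unfolding functional_def by (metis mult_zero_left)
  then have "f 0 = 0" by simp
  then show ?thesis
    using assms unfolding functional_def by (induction X rule: infinite_finite_induct) simp_all
qed

definition eqv :: "('v \<Rightarrow> complex) \<Rightarrow> int \<Rightarrow> ('k \<Rightarrow> complex) \<Rightarrow> bool" where
  "eqv f i \<theta> \<longleftrightarrow> (\<forall>r v. f (\<pi> (root_elt i r) v) = \<theta> r * f v)"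

text \<open>This transfers \<open>whittaker_unique\<close> from vectors to functionals without the
  dual representation: a Whittaker functional is determined by its restriction to the range of
  \<open>whit\<close>.\<close>

lemma whittaker_functional:
  assumes f: "functional f" and eqv: "\<And>i. i \<in> {0, 1, 2, 3, 4, 5} \<Longrightarrow> eqv f i (\<lambda>r. \<psi> (simple_sum (root_elt i r)))"
  shows "f (whit v) = of_nat (card (U_borel :: ('k^7^7) set)) * f v"
proof -
  have "f (\<pi> u v) = theta u * f v" if "u \<in> U_borel" for u v
    using that unfolding root_group_eq
  proof (induction rule: root_group_induct)
    case one
    then show ?case by (simp add: pi_one theta_def simple_sum_one psi_0)
  next
    case (mult i r u)
    have U: "u \<in> U_borel" "root_elt i r \<in> U_borel"
      unfolding root_group_eq using mult.hyps by (auto intro: root_group_elt)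
    have "f (\<pi> (root_elt i r ** u) v) = f (\<pi> (root_elt i r) (\<pi> u v))"
      using U by (simp add: pi_mult U_borel_G2)
    also have "\<dots> = \<psi> (simple_sum (root_elt i r)) * (theta u * f v)"
      using eqv[OF mult.hyps(1)] mult.IH unfolding eqv_def by simp
    also have "\<dots> = theta (root_elt i r ** u) * f v"
      unfolding theta_def simple_sum_U_borel[OF U(2,1)] psi_add by simp
    finally show ?case .
  qed
  then have "f (whit v) = (\<Sum>u\<in>(U_borel :: ('k^7^7) set). \<psi> (- simple_sum u) * (theta u * f v))"
    using f unfolding whit_def functional_sum[OF f] by (simp add: functional_def)
  also have "\<dots> = (\<Sum>u\<in>(U_borel :: ('k^7^7) set). f v)"
    by (rule sum.cong) (simp_all add: theta_def mult.assoc[symmetric] psi_minus)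
  finally show ?thesis by simp
qed

text \<open>Cuspidality is stated for invariant vectors. The average of v over \<open>V'_rad\<close>
  is such a vector, hence 0, while an invariant functional takes on it a nonzero multiple of its
  value at v.\<close>

lemma cuspidal_functional:
  assumes f: "functional f" and eqv: "\<And>i. i \<in> {1, 2, 3, 4, 5} \<Longrightarrow> eqv f i (\<lambda>r. 1)"
  shows "f v = 0"
proof -
  let ?N = "V'_rad :: ('k^7^7) set"
  have "matrix_inv (mat 1) = (mat 1 :: 'k^7^7)" by (rule matrix_inv_unique) simp_all
  then have "?N = (\<lambda>u. mat 1 ** u ** matrix_inv (mat 1)) ` ?N" by simp
  then have "?N \<in> unipotent_radicals"
    unfolding unipotent_radicals_def using G2_one by blast
  then have fixed: "{v. \<forall>u\<in>?N. \<pi> u v = v} = {0}"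
    using cuspidal unfolding cuspidal_G2_def by blast
  have mult: "u ** w \<in> ?N" if "u \<in> ?N" "w \<in> ?N" for u w
    using that unfolding root_group_eq by (rule root_group_mult)
  have inv: "matrix_inv u \<in> ?N" "invertible u" if "u \<in> ?N" for u
    using that unfolding root_group_eq by (auto intro: root_group_inv root_group_invertible)
  have N_G2: "u \<in> G2" if "u \<in> ?N" for u
    using that unfolding root_group_eq(2)
    by (induction rule: root_group_induct) (auto intro!: G2_one G2_mult root_elt_G2)
  define avg where "avg = (\<Sum>u\<in>?N. \<pi> u v)"
  have "\<pi> w avg = avg" if w: "w \<in> ?N" for w
  proof -
    have "\<pi> w avg = (\<Sum>u\<in>?N. \<pi> (w ** u) v)"
      unfolding avg_def using w by (simp add: pi_hom pi_mult N_G2)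
    also have "\<dots> = avg" unfolding avg_def
      by (rule sum.reindex_bij_betw, rule bij_betw_byWitness[of _ "\<lambda>u. matrix_inv w ** u"])
        (use w in \<open>auto simp: matrix_mul_assoc matrix_inv_mult inv intro: mult inv\<close>)
    finally show ?thesis .
  qed
  then have "avg = 0" using fixed by blast
  then have "f avg = 0" using functional_sum[OF f, of "\<lambda>x. x" "{}"] by simp
  moreover have "f (\<pi> u v) = f v" if "u \<in> ?N" for u v
    using that unfolding root_group_eq
  proof (induction rule: root_group_induct)
    case one
    then show ?case by (simp add: pi_one)
  next
    case (mult i r u)
    have "u \<in> G2" by (rule N_G2) (simp add: root_group_eq mult.hyps)
    moreover have "root_elt i r \<in> (G2 :: ('k^7^7) set)"
      by (rule root_elt_G2) (use mult.hyps in auto)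
    ultimately show ?case using eqv[OF mult.hyps(1)] mult.IH by (simp add: pi_mult eqv_def)
  qed
  ultimately have "(\<Sum>u\<in>?N. f v) = 0" unfolding avg_def functional_sum[OF f] by simp
  moreover have "?N \<noteq> {}" using root_group_one unfolding root_group_eq by blast
  ultimately show ?thesis by simp
qed

lemma character_sum: "(\<Sum>t\<in>UNIV. \<psi> (c * t)) = (if c = 0 then of_nat CARD('k) else 0)"
proof (cases "c = 0")
  case False
  obtain a where a: "\<psi> a \<noteq> 1" using psi by (auto simp: nontrivial_additive_character_def)
  have "(\<Sum>t\<in>UNIV. \<psi> (c * t)) = (\<Sum>t\<in>UNIV. \<psi> (c * (t + a / c)))"
    by (rule sum_shift[symmetric])
  also have "\<dots> = \<psi> a * (\<Sum>t\<in>UNIV. \<psi> (c * t))"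
    using False by (simp add: distrib_left psi_add sum_distrib_left mult.commute)
  finally show ?thesis using a False by simp
qed (simp add: psi_0)

section \<open>Conjugation, root exchange and Fourier coefficients of functionals\<close>

definition conj_fun :: "('v \<Rightarrow> complex) \<Rightarrow> 'v \<Rightarrow> complex" where
  "conj_fun f v = f (\<pi> (refl_a ** refl_b) v)"

text \<open>U_{\<alpha>+\<beta>} is the one root subgroup of V whose action on
  \<open>conj_fun f\<close> is not yet controlled, so the sum runs over it.\<close>

definition exch :: "('v \<Rightarrow> complex) \<Rightarrow> 'v \<Rightarrow> complex" where
  "exch f v = (\<Sum>r\<in>UNIV. f (\<pi> (root_elt 4 r) v))"

definition fourier :: "'k \<Rightarrow> ('v \<Rightarrow> complex) \<Rightarrow> 'v \<Rightarrow> complex" where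
  "fourier b f v = (\<Sum>t\<in>UNIV. \<psi> (- (b * t)) * f (\<pi> (root_elt 5 t) v))"

lemma functional_ops:
  assumes "functional f"
  shows "functional (conj_fun f)" "functional (exch f)" "functional (fourier b f)"
proof -
  have w: "refl_a ** refl_b \<in> (G2 :: ('k^7^7) set)" by (intro G2_mult refl_a_G2 refl_b_G2)
  have x: "root_elt 4 r \<in> (G2 :: ('k^7^7) set)" "root_elt 5 r \<in> (G2 :: ('k^7^7) set)" for r
    by (simp_all add: root_elt_G2)
  show "functional (conj_fun f)" "functional (exch f)" "functional (fourier b f)"
    using assms unfolding functional_def conj_fun_def exch_def fourier_def
    by (simp_all add: pi_hom w x sum.distrib sum_distrib_left distrib_left mult.left_commute)
qed

lemma pi_root_elt: "i \<in> {0, 1, 2, 3, 4, 5, 6, 11} \<Longrightarrow> g \<in> G2 \<Longrightarrow>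
    \<pi> (root_elt i r ** g) v = \<pi> (root_elt i r) (\<pi> g v)"
  by (simp add: pi_mult root_elt_G2)

lemma pi_assoc: "i \<in> {0, 1, 2, 3, 4, 5, 6, 11} \<Longrightarrow> j \<in> {0, 1, 2, 3, 4, 5, 6, 11} \<Longrightarrow>
    \<pi> (root_elt i r) (\<pi> (root_elt j t) v) = \<pi> (root_elt i r ** root_elt j t) v"
  by (simp add: pi_mult root_elt_G2)

lemma conj_fun_eqv:
  assumes "eqv f 2 \<psi>" "\<And>i. i \<in> {1, 3, 4, 5} \<Longrightarrow> eqv f i (\<lambda>r. 1)"
  shows "eqv (conj_fun f) 0 \<psi>" "\<And>i. i \<in> {1, 2, 3, 11} \<Longrightarrow> eqv (conj_fun f) i (\<lambda>r. 1)"
proof -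
  let ?w = "refl_a ** refl_b :: 'k^7^7"
  have w: "?w \<in> G2" by (intro G2_mult refl_a_G2 refl_b_G2)
  have conj: "eqv (conj_fun f) i (\<lambda>r. \<theta> (c * r))"
    if "\<And>r. ?w ** root_elt i r = root_elt j (c * r) ** ?w" "eqv f j \<theta>"
      "i \<in> {0, 1, 2, 3, 4, 5, 6, 11}" "j \<in> {0, 1, 2, 3, 4, 5, 6, 11}" for i j c \<theta>
  proof -
    have "\<pi> ?w (\<pi> (root_elt i r) v) = \<pi> (root_elt j (c * r)) (\<pi> ?w v)" for r v
      using that(1)[of r] w that(3,4) by (simp add: pi_mult[symmetric] root_elt_G2)
    then show ?thesis using that(2) by (simp add: eqv_def conj_fun_def)
  qed
  show "eqv (conj_fun f) 0 \<psi>" using conj[of 0 2 1, OF _ assms(1)] by (simp add: coxeter_conj)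
  show "eqv (conj_fun f) i (\<lambda>r. 1)" if "i \<in> {1, 2, 3, 11}" for i
    using that conj[of 1 3 1, OF _ assms(2)] conj[of 2 4 "-1", OF _ assms(2)]
      conj[of 3 5 1, OF _ assms(2)] conj[of 11 1 "-1", OF _ assms(2)]
    by (auto simp: coxeter_conj)
qed

text \<open>Commutators of U_{\<alpha>+\<beta>} with the other root subgroups of V lie in the roots
  1, 2, 3, where f is invariant.\<close>

lemma exch_eqv:
  assumes "eqv f 0 \<psi>" "\<And>i. i \<in> {1, 2, 3} \<Longrightarrow> eqv f i (\<lambda>r. 1)"
  shows "eqv (exch f) 0 \<psi>" "\<And>i. i \<in> {1, 2, 3, 4} \<Longrightarrow> eqv (exch f) i (\<lambda>r. 1)"
proof -
  have f: "f (\<pi> (root_elt 0 r) v) = \<psi> r * f v" "f (\<pi> (root_elt 1 r) v) = f v"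
    "f (\<pi> (root_elt 2 r) v) = f v" "f (\<pi> (root_elt 3 r) v) = f v" for r v
    using assms by (simp_all add: eqv_def)
  have comm: "f (\<pi> (root_elt 4 r) (\<pi> (root_elt 0 t) v)) = \<psi> t * f (\<pi> (root_elt 4 r) v)"
    "f (\<pi> (root_elt 4 r) (\<pi> (root_elt 1 t) v)) = f (\<pi> (root_elt 4 r) v)"
    "f (\<pi> (root_elt 4 r) (\<pi> (root_elt 2 t) v)) = f (\<pi> (root_elt 4 r) v)"
    "f (\<pi> (root_elt 4 r) (\<pi> (root_elt 3 t) v)) = f (\<pi> (root_elt 4 r) v)" for r t v
    by (simp_all add: pi_assoc commutators)
      (simp_all add: matrix_mul_assoc[symmetric] pi_root_elt root_elt_G2 G2_mult f)
  show "eqv (exch f) 0 \<psi>" by (simp add: eqv_def exch_def comm sum_distrib_left)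
  have "eqv (exch f) 4 (\<lambda>r. 1)"
    unfolding eqv_def exch_def
    by (simp add: pi_assoc root_elt_add sum_shift[of "\<lambda>r. f (\<pi> (root_elt 4 r) _)"])
  then show "eqv (exch f) i (\<lambda>r. 1)" if "i \<in> {1, 2, 3, 4}" for i
    using that by (auto simp: eqv_def exch_def comm)
qed

text \<open>Moving U_{-\<beta>} through U_{\<alpha>+\<beta>} produces the factor \<psi>(-rt), and
  the sum over t leaves only r = 0. Thus \<open>exch\<close> is injective on these
  functionals.\<close>

lemma exch_inverse:
  assumes "eqv f 0 \<psi>" "\<And>i. i \<in> {1, 2, 3, 11} \<Longrightarrow> eqv f i (\<lambda>r. 1)"
  shows "(\<Sum>t\<in>UNIV. exch f (\<pi> (root_elt 11 t) v)) = of_nat CARD('k) * f v"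
proof -
  have f: "f (\<pi> (root_elt 0 r) v) = \<psi> r * f v" "f (\<pi> (root_elt 1 r) v) = f v"
    "f (\<pi> (root_elt 2 r) v) = f v" "f (\<pi> (root_elt 3 r) v) = f v" "f (\<pi> (root_elt 11 r) v) = f v" for r v
    using assms by (simp_all add: eqv_def)
  have comm: "f (\<pi> (root_elt 4 r) (\<pi> (root_elt 11 t) v)) = \<psi> (- r * t) * f (\<pi> (root_elt 4 r) v)" for r t
    by (simp add: pi_assoc commutators)
      (simp add: matrix_mul_assoc[symmetric] pi_root_elt root_elt_G2 G2_mult f)
  have "(\<Sum>t\<in>UNIV. exch f (\<pi> (root_elt 11 t) v)) =
      (\<Sum>r\<in>UNIV. \<Sum>t\<in>UNIV. \<psi> (- r * t) * f (\<pi> (root_elt 4 r) v))"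
    unfolding exch_def comm by (rule sum.swap)
  also have "\<dots> = (\<Sum>r\<in>UNIV. (if - r = 0 then of_nat CARD('k) else 0) * f (\<pi> (root_elt 4 r) v))"
    by (simp only: sum_distrib_right[symmetric] character_sum)
  also have "\<dots> = (\<Sum>r\<in>UNIV. if r = 0 then of_nat CARD('k) * f (\<pi> (root_elt 4 r) v) else 0)"
    by (rule sum.cong) auto
  also have "\<dots> = of_nat CARD('k) * f v" by (simp add: root_elt_0 pi_one)
  finally show ?thesis .
qed

lemma fourier_eqv:
  assumes "eqv f 0 \<psi>" "\<And>i. i \<in> {1, 2, 3, 4} \<Longrightarrow> eqv f i (\<lambda>r. 1)"
  shows "eqv (fourier b f) 0 \<psi>" "\<And>i. i \<in> {1, 2, 3, 4} \<Longrightarrow> eqv (fourier b f) i (\<lambda>r. 1)"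
    "eqv (fourier b f) 5 (\<lambda>r. \<psi> (b * r))"
proof -
  have f: "f (\<pi> (root_elt 0 r) v) = \<psi> r * f v" "f (\<pi> (root_elt 1 r) v) = f v"
    "f (\<pi> (root_elt 2 r) v) = f v" "f (\<pi> (root_elt 3 r) v) = f v" "f (\<pi> (root_elt 4 r) v) = f v" for r v
    using assms by (simp_all add: eqv_def)
  have comm: "f (\<pi> (root_elt 5 r) (\<pi> (root_elt 0 t) v)) = \<psi> t * f (\<pi> (root_elt 5 r) v)"
    "f (\<pi> (root_elt 5 r) (\<pi> (root_elt 1 t) v)) = f (\<pi> (root_elt 5 r) v)"
    "f (\<pi> (root_elt 5 r) (\<pi> (root_elt 2 t) v)) = f (\<pi> (root_elt 5 r) v)"
    "f (\<pi> (root_elt 5 r) (\<pi> (root_elt 3 t) v)) = f (\<pi> (root_elt 5 r) v)"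
    "f (\<pi> (root_elt 5 r) (\<pi> (root_elt 4 t) v)) = f (\<pi> (root_elt 5 r) v)" for r t v
    by (simp_all add: pi_assoc commutators)
      (simp_all add: matrix_mul_assoc[symmetric] pi_root_elt root_elt_G2 G2_mult f)
  show "eqv (fourier b f) 0 \<psi>"
    by (simp add: eqv_def fourier_def comm sum_distrib_left mult.left_commute)
  show "eqv (fourier b f) i (\<lambda>r. 1)" if "i \<in> {1, 2, 3, 4}" for i
    using that by (auto simp: eqv_def fourier_def comm)
  show "eqv (fourier b f) 5 (\<lambda>r. \<psi> (b * r))"
    unfolding eqv_def
  proof (intro allI)
    fix r v
    have "fourier b f (\<pi> (root_elt 5 r) v) = (\<Sum>t\<in>UNIV. \<psi> (- (b * t)) * f (\<pi> (root_elt 5 (t + r)) v))"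
      unfolding fourier_def by (simp add: pi_assoc root_elt_add)
    also have "\<dots> = (\<Sum>t\<in>UNIV. \<psi> (b * r) * (\<psi> (- (b * (t + r))) * f (\<pi> (root_elt 5 (t + r)) v)))"
      by (rule sum.cong) (simp_all add: mult.assoc[symmetric] psi_add[symmetric] algebra_simps)
    also have "\<dots> = \<psi> (b * r) * fourier b f v"
      unfolding fourier_def sum_distrib_left
      by (rule sum_shift[of "\<lambda>t. \<psi> (b * r) * (\<psi> (- (b * t)) * f (\<pi> (root_elt 5 t) v))"])
    finally show "fourier b f (\<pi> (root_elt 5 r) v) = \<psi> (b * r) * fourier b f v" .
  qed
qed

lemma fourier_inversion: "(\<Sum>b\<in>UNIV. fourier b f v) = of_nat CARD('k) * f v"
proof -
  have "(\<Sum>b\<in>UNIV. fourier b f v) =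
      (\<Sum>t\<in>UNIV. \<Sum>b\<in>UNIV. \<psi> (- t * b) * f (\<pi> (root_elt 5 t) v))"
    unfolding fourier_def by (subst sum.swap) (simp add: mult.commute)
  also have "\<dots> = (\<Sum>t\<in>UNIV. (if - t = 0 then of_nat CARD('k) else 0) * f (\<pi> (root_elt 5 t) v))"
    by (simp only: sum_distrib_right[symmetric] character_sum)
  also have "\<dots> = (\<Sum>t\<in>UNIV. if t = 0 then of_nat CARD('k) * f (\<pi> (root_elt 5 t) v) else 0)"
    by (rule sum.cong) auto
  also have "\<dots> = of_nat CARD('k) * f v" by (simp add: root_elt_0 pi_one)
  finally show ?thesis .
qed

lemma pi_torus_root:
  assumes "c \<noteq> 0" "i \<in> {0, 1, 2, 3, 4, 5}"
  shows "\<pi> (h_torus c 1) (\<pi> (root_elt i r) v) = \<pi> (root_elt i (root_char i c 1 * r)) (\<pi> (h_torus c 1) v)"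
proof -
  have "root_elt i t \<in> (G2 :: ('k^7^7) set)" for t
    by (rule root_elt_G2) (use assms in auto)
  then show ?thesis
    using h_torus_conj[of c 1 i r] assms(1) by (simp add: pi_mult[symmetric] h_torus_G2)
qed

lemma torus_conj_fun:
  assumes "c \<noteq> 0" "\<And>v. f (\<pi> (h_torus c (inverse c)) v) = d * f v"
  shows "conj_fun f (\<pi> (h_torus c 1) v) = d * conj_fun f v"
proof -
  have w: "refl_a ** refl_b \<in> (G2 :: ('k^7^7) set)" by (intro G2_mult refl_a_G2 refl_b_G2)
  show ?thesis
    using assms(2)[of "\<pi> (refl_a ** refl_b) v"] unfolding conj_fun_def
    by (simp add: pi_mult[symmetric] h_torus_G2[OF assms(1)] w coxeter_conj assms(1))
qed

lemma torus_exch: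
  assumes c: "c \<noteq> 0" and f: "\<And>v. f (\<pi> (h_torus c 1) v) = d * f v"
  shows "exch f (\<pi> (h_torus c 1) v) = d * exch f v"
proof -
  have "exch f (\<pi> (h_torus c 1) v) = (\<Sum>r\<in>UNIV. f (\<pi> (root_elt 4 (c * r)) (\<pi> (h_torus c 1) v)))"
    unfolding exch_def by (rule sum_scale[OF c, symmetric])
  also have "\<dots> = (\<Sum>r\<in>UNIV. d * f (\<pi> (root_elt 4 r) v))"
    using pi_torus_root[OF c, of 4] by (simp add: root_char_def f[symmetric])
  finally show ?thesis by (simp add: exch_def sum_distrib_left)
qed

text \<open>\<open>h_torus c 1\<close> scales U_\<beta> by c, so substituting ct for t in the
  coefficient of frequency 1 yields frequency c.\<close>

lemma torus_fourier:
  assumes c: "c \<noteq> 0" and f: "\<And>v. f (\<pi> (h_torus c 1) v) = d * f v"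
  shows "fourier 1 f (\<pi> (h_torus c 1) v) = d * fourier c f v"
proof -
  have "fourier 1 f (\<pi> (h_torus c 1) v) =
      (\<Sum>r\<in>UNIV. \<psi> (- (1 * (c * r))) * f (\<pi> (root_elt 5 (c * r)) (\<pi> (h_torus c 1) v)))"
    unfolding fourier_def by (rule sum_scale[OF c, symmetric])
  also have "\<dots> = (\<Sum>r\<in>UNIV. \<psi> (- (c * r)) * (d * f (\<pi> (root_elt 5 r) v)))"
    using pi_torus_root[OF c, of 5] by (simp add: root_char_def f[symmetric])
  finally show ?thesis by (simp add: fourier_def sum_distrib_left mult.left_commute)
qed

text \<open>Fourier expansion along \<open>U\<^sub>\<beta>\<close> and root exchange recover a functional from its Whittaker
  coefficient: by cuspidality the constant term vanishes, and the torus permutes the other terms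
  transitively.\<close>

lemma functional_zero:
  assumes f: "functional f" and eqv: "eqv f 2 \<psi>" "\<And>i. i \<in> {1, 3, 4, 5} \<Longrightarrow> eqv f i (\<lambda>r. 1)"
    and torus: "\<And>c. c \<noteq> 0 \<Longrightarrow> \<exists>d. d \<noteq> 0 \<and> (\<forall>v. f (\<pi> (h_torus c (inverse c)) v) = d * f v)"
    and w: "\<And>v. \<exists>c. whit v = s c w" and zero: "fourier 1 (exch (conj_fun f)) w = 0"
  shows "f v = 0"
proof -
  define f1 where "f1 = conj_fun f"
  define f2 where "f2 = exch f1"
  have q: "of_nat CARD('k) \<noteq> (0 :: complex)" by simp
  have lin: "functional f1" "functional f2" "functional (fourier b f2)" for b
    using f by (simp_all add: f1_def f2_def functional_ops)
  have eqv1: "eqv f1 0 \<psi>" "\<And>i. i \<in> {1, 2, 3, 11} \<Longrightarrow> eqv f1 i (\<lambda>r. 1)"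
    unfolding f1_def using conj_fun_eqv[OF eqv] by blast+
  have eqv2: "eqv f2 0 \<psi>" "\<And>i. i \<in> {1, 2, 3, 4} \<Longrightarrow> eqv f2 i (\<lambda>r. 1)"
    unfolding f2_def using exch_eqv[OF eqv1(1)] eqv1(2) by blast+
  note eqv3 = fourier_eqv[OF eqv2]
  have 1: "fourier 1 f2 v = 0" for v
  proof -
    have "fourier 1 f2 (whit v) = of_nat (card (U_borel :: ('k^7^7) set)) * fourier 1 f2 v"
    proof (rule whittaker_functional[OF lin(3)])
      show "eqv (fourier 1 f2) i (\<lambda>r. \<psi> (simple_sum (root_elt i r)))" if "i \<in> {0, 1, 2, 3, 4, 5}" for i
        using that eqv3[where b = 1] by (auto simp: simple_sum_root_elt psi_0)
    qed
    moreover have "fourier 1 f2 (whit v) = 0"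
      using w[of v] zero lin(3)[of 1] unfolding functional_def f1_def f2_def by auto
    ultimately show ?thesis using card_U_borel by simp
  qed
  have "fourier b f2 v = 0" for b v
  proof (cases "b = 0")
    case True
    show ?thesis
    \<comment> \<open>At frequency 0 the functional is invariant under U_\<beta> as well, hence
      under all of \<open>V'_rad\<close>.\<close>
    proof (rule cuspidal_functional[OF lin(3)])
      show "eqv (fourier b f2) i (\<lambda>r. 1)" if "i \<in> {1, 2, 3, 4, 5}" for i
        using that eqv3[where b = b] True by (auto simp: psi_0)
    qed
  next
    case False
    then obtain d where d: "d \<noteq> 0" "\<And>v. f (\<pi> (h_torus b (inverse b)) v) = d * f v"
      using torus by blast
    have "fourier 1 f2 (\<pi> (h_torus b 1) v) = d * fourier b f2 v"
      unfolding f2_def f1_def using False d(2)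
      by (intro torus_fourier torus_exch torus_conj_fun)
    then show ?thesis using 1 d(1) by simp
  qed
  then have "f2 v = 0" for v using fourier_inversion[of f2 v] q by simp
  then have "f1 v = 0" for v using exch_inverse[OF eqv1, of v] q unfolding f2_def by simp
  then have "f (\<pi> (refl_a ** refl_b) (\<pi> (matrix_inv (refl_a ** refl_b)) v)) = 0"
    unfolding f1_def conj_fun_def .
  moreover have "refl_a ** refl_b \<in> (G2 :: ('k^7^7) set)" by (intro G2_mult refl_a_G2 refl_b_G2)
  ultimately show ?thesis
    by (simp add: pi_mult[symmetric] G2_inv matrix_inv_mult[OF G2_invertible] pi_one)
qed

end


section \<open>Fourier--Jacobi homomorphisms\<close>

lemma inverse_SL2:
  assumes "m \<in> SL2"
  defines "m' \<equiv> vector [vector [m$2$2, - m$1$2], vector [- m$2$1, m$1$1]]"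
  shows "m ** m' = mat 1" "m' ** m = mat 1" "m' \<in> SL2" "matrix_inv m = m'"
proof -
  have d: "m$1$1 * m$2$2 - m$1$2 * m$2$1 = 1" using assms(1) by (simp add: SL2_def det_2)
  show 1: "m ** m' = mat 1" "m' ** m = mat 1"
    using d by (simp_all add: m'_def vec_eq_iff forall_2 matrix_matrix_mult_def sum_2 mat_def algebra_simps)
  show "m' \<in> SL2" using d by (simp add: m'_def SL2_def det_2 mult.commute)
  show "matrix_inv m = m'" using 1 by (rule matrix_inv_unique)
qed

lemma levi_act:
  assumes "m \<in> SL2"
  shows "levi m *v vec7 a b c d e f g =
    vec7 (m$1$1 * a + m$1$2 * b) (m$2$1 * a + m$2$2 * b) c d e
      (m$1$1 * f - m$1$2 * g) (m$2$2 * g - m$2$1 * f)"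
proof -
  have "det m = 1" using assms by (simp add: SL2_def)
  moreover have "dual2 m $ 1 $ 1 = m$1$1" "dual2 m $ 1 $ 2 = - m$1$2"
    "dual2 m $ 2 $ 1 = - m$2$1" "dual2 m $ 2 $ 2 = m$2$2"
    unfolding dual2_def inverse_SL2(4)[OF assms]
    by (simp_all add: matrix_matrix_mult_def sum_2 transpose_def)
  ultimately show ?thesis
    unfolding levi_def vec_eq_iff forall_7 by (simp add: matrix_vector_mult_add_rdistrib)
qed

lemma SL2_mult: "m \<in> SL2 \<Longrightarrow> n \<in> SL2 \<Longrightarrow> m ** n \<in> SL2"
  by (simp add: SL2_def det_mul)

lemma SL2_one: "mat 1 \<in> SL2"
  by (simp add: SL2_def)

lemma levi_mult: "m \<in> SL2 \<Longrightarrow> n \<in> SL2 \<Longrightarrow> levi (m ** n) = levi m ** levi n"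
  by (intro matrix_eq_vec7)
    (simp add: matrix_act levi_act SL2_mult, simp add: matrix_matrix_mult_def sum_2 algebra_simps)

lemma levi_one: "levi (mat 1) = mat 1"
  by (intro matrix_eq_vec7) (simp add: levi_act[OF SL2_one] matrix_act, simp add: mat_def)

lemma x_b_levi:
  "vector [vector [1, b], vector [0, 1]] \<in> SL2" "levi (vector [vector [1, b], vector [0, 1]]) = x_b b"
proof -
  show SL2: "vector [vector [1, b], vector [0, 1]] \<in> SL2" by (simp add: SL2_def det_2)
  show "levi (vector [vector [1, b], vector [0, 1]]) = x_b b"
    by (intro matrix_eq_vec7) (simp add: levi_act[OF SL2] x_act)
qed

lemma h_torus_levi:
  assumes "a \<noteq> 0"
  shows "vector [vector [a, 0], vector [0, inverse a]] \<in> SL2"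
    "levi (vector [vector [a, 0], vector [0, inverse a]]) = h_torus a (inverse a)"
proof -
  show SL2: "vector [vector [a, 0], vector [0, inverse a]] \<in> SL2" using assms by (simp add: SL2_def det_2)
  show "levi (vector [vector [a, 0], vector [0, inverse a]]) = h_torus a (inverse a)"
    using assms by (intro matrix_eq_vec7) (simp add: levi_act[OF SL2])
qed

lemma J_levi: "m \<in> SL2 \<Longrightarrow> levi m \<in> J_grp" "m \<in> SL2 \<Longrightarrow> J_to_SL2 (levi m) = m"
proof -
  assume m: "m \<in> SL2"
  have one: "mat 1 \<in> (V_rad :: ('a^7^7) set)" unfolding root_group_eq by (rule root_group_one)
  show "levi m \<in> J_grp" unfolding J_grp_def using m one by (metis (mono_tags, lifting) matrix_mul_rid mem_Collect_eq)
  show "J_to_SL2 (levi m) = m" using J_to_SL2_levi[OF m one] by simp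
qed

lemma J_radical: "v \<in> V_rad \<Longrightarrow> v \<in> J_grp" "v \<in> V_rad \<Longrightarrow> J_to_SL2 v = mat 1"
proof -
  assume v: "v \<in> V_rad"
  show "v \<in> J_grp" unfolding J_grp_def using v SL2_one levi_one
    by (metis (mono_tags, lifting) matrix_mul_lid mem_Collect_eq)
  show "J_to_SL2 v = mat 1" using J_to_SL2_levi[OF SL2_one v] by (simp add: levi_one)
qed

lemma V_rad_elt: "i \<in> {0, 1, 2, 3, 4} \<Longrightarrow> root_elt i r \<in> V_rad"
  unfolding root_group_eq by (rule root_group_elt)

lemma tensor_space_slice:
  assumes "F \<in> I_tensor_weil_space chi"
  shows "(\<lambda>g. F (g, \<xi>)) \<in> I_chi chi"
proof -
  interpret v: vector_space "pointwise (*) :: complex \<Rightarrow> (('a^2^2) \<times> 'a \<Rightarrow> complex) \<Rightarrow> _"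
    by (rule vector_space_pointwise[OF vector_space_mult])
  show ?thesis
    using assms unfolding I_tensor_weil_space_def tensor_space_def
  proof (induction rule: v.span_induct_alt)
    case base
    show ?case by (simp add: I_chi_def)
  next
    case (step c x y)
    then obtain f \<phi> where "x = pure_tensor f \<phi>" "f \<in> I_chi chi" by blast
    with step(2) show ?case
      unfolding I_chi_def pure_tensor_def pointwise_def
      by (simp add: algebra_simps)
  qed
qed


lemma I_tensor_weil_action_apply:
  "I_tensor_weil_action \<omega> g F (m, \<xi>) = \<omega> g (\<lambda>y. F (m ** J_to_SL2 g, y)) \<xi>"
  by (simp add: I_tensor_weil_action_def tensor_op_def right_translation_def)

locale fourier_jacobi = cuspidal s \<pi> \<psi>
  for s :: "complex \<Rightarrow> 'v::ab_group_add \<Rightarrow> 'v"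
    and \<pi> :: "'k::{field,finite}^7^7 \<Rightarrow> 'v \<Rightarrow> 'v"
    and \<psi> :: "'k \<Rightarrow> complex" +
  fixes \<omega> :: "'k^7^7 \<Rightarrow> ('k \<Rightarrow> complex) \<Rightarrow> ('k \<Rightarrow> complex)"
    and chi :: "'k \<Rightarrow> complex"
  assumes weil: "weil_representation \<psi> \<omega>"
    and chi: "multiplicative_character chi"
begin

abbreviation homs :: "('v \<Rightarrow> ('k^2^2) \<times> 'k \<Rightarrow> complex) set" where
  "homs \<equiv> Hom_rep J_grp s \<pi> (pointwise (*)) (I_tensor_weil_space chi) (I_tensor_weil_action \<omega>)"

lemma hom_add_scale:
  assumes "T \<in> homs"
  shows "T (v + w) p = T v p + T w p" "T (s c v) p = c * T v p"
proof -
  have "Vector_Spaces.linear s (pointwise (*)) T" using assms by (simp add: Hom_rep_def)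
  then interpret T: Vector_Spaces.linear s "pointwise (*)" T .
  show "T (v + w) p = T v p + T w p" "T (s c v) p = c * T v p"
    by (simp_all add: T.add T.scale pointwise_def)
qed

lemma hom_apply:
  "T \<in> homs \<Longrightarrow> g \<in> J_grp \<Longrightarrow> T (\<pi> g v) (m, \<xi>) = \<omega> g (\<lambda>y. T v (m ** J_to_SL2 g, y)) \<xi>"
  by (simp add: Hom_rep_def I_tensor_weil_action_apply)

lemma hom_radical:
  "T \<in> homs \<Longrightarrow> i \<in> {0, 1, 2, 3, 4} \<Longrightarrow>
   T (\<pi> (root_elt i r) v) (m, \<xi>) = \<omega> (root_elt i r) (\<lambda>y. T v (m, y)) \<xi>"
  by (simp only: hom_apply J_radical V_rad_elt matrix_mul_rid)

lemma hom_levi: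
  "T \<in> homs \<Longrightarrow> n \<in> SL2 \<Longrightarrow> T (\<pi> (levi n) v) (m, \<xi>) = \<omega> (levi n) (\<lambda>y. T v (m ** n, y)) \<xi>"
  by (simp only: hom_apply J_levi)

lemma hom_I_chi: "T \<in> homs \<Longrightarrow> (\<lambda>g. T v (g, \<xi>)) \<in> I_chi chi"
  by (rule tensor_space_slice) (auto simp: Hom_rep_def)

lemma hom_borel:
  assumes "T \<in> homs" "a \<noteq> 0"
  shows "T v (vector [vector [a, b], vector [0, inverse a]], \<xi>) = chi a * T v (mat 1, \<xi>)"
  using hom_I_chi[OF assms(1), of v \<xi>] assms(2) SL2_one unfolding I_chi_def
  by (auto dest!: spec bspec simp: matrix_mul_rid)

lemma omega_root:
  "\<omega> (root_elt 0 r) \<phi> \<xi> = \<phi> (\<xi> + r)" "\<omega> (root_elt 1 r) \<phi> \<xi> = \<phi> \<xi>"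
  "\<omega> (root_elt 2 r) \<phi> \<xi> = \<psi> r * \<phi> \<xi>" "\<omega> (root_elt 3 r) \<phi> \<xi> = \<phi> \<xi>"
  "\<omega> (root_elt 4 r) \<phi> \<xi> = \<psi> (- 2 * \<xi> * r) * \<phi> \<xi>" "\<omega> (root_elt 5 r) \<phi> \<xi> = \<psi> (r * \<xi>^2) * \<phi> \<xi>"
proof -
  have "\<omega> (root_elt 0 r1 ** root_elt 2 r3 ** root_elt 1 r4 ** root_elt 3 r5) \<phi> \<xi> = \<psi> r3 * \<phi> (\<xi> + r1)"
    for r1 r3 r4 r5
    using weil by (simp add: weil_representation_def root_elt_pos)
  from this[of r 0 0 0] this[of 0 0 r 0] this[of 0 r 0 0] this[of 0 0 0 r]
  show "\<omega> (root_elt 0 r) \<phi> \<xi> = \<phi> (\<xi> + r)" "\<omega> (root_elt 1 r) \<phi> \<xi> = \<phi> \<xi>"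
    "\<omega> (root_elt 2 r) \<phi> \<xi> = \<psi> r * \<phi> \<xi>" "\<omega> (root_elt 3 r) \<phi> \<xi> = \<phi> \<xi>"
    by (simp_all add: root_elt_0 psi_0)
  show "\<omega> (root_elt 4 r) \<phi> \<xi> = \<psi> (- 2 * \<xi> * r) * \<phi> \<xi>" "\<omega> (root_elt 5 r) \<phi> \<xi> = \<psi> (r * \<xi>^2) * \<phi> \<xi>"
    using weil by (simp_all add: weil_representation_def root_elt_pos)
qed

lemma omega_torus: "a \<noteq> 0 \<Longrightarrow> \<omega> (h_torus a (inverse a)) \<phi> \<xi> = quadratic_character a * \<phi> (a * \<xi>)"
  using weil by (simp add: weil_representation_def)

text \<open>Frobenius reciprocity: evaluation at \<open>g = 1\<close> and \<open>\<xi> = 0\<close> turns the homomorphism into a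
  functional that determines it.\<close>

definition eval_one :: "('v \<Rightarrow> ('k^2^2) \<times> 'k \<Rightarrow> complex) \<Rightarrow> 'v \<Rightarrow> complex" where
  "eval_one T v = T v (mat 1, 0)"

text \<open>At \<xi> = 0 the Weil characters of U_{\<alpha>+\<beta>} and U_\<beta> become trivial,
  and functions in \<open>I_chi\<close> are left invariant under unipotent matrices because
  \<open>chi 1 = 1\<close>.\<close>

lemma eval_one_eqv:
  assumes T: "T \<in> homs"
  shows "eqv (eval_one T) 2 \<psi>" "\<And>i. i \<in> {1, 3, 4, 5} \<Longrightarrow> eqv (eval_one T) i (\<lambda>r. 1)"
proof -
  show "eqv (eval_one T) 2 \<psi>"
    by (simp add: eqv_def eval_one_def hom_radical[OF T] omega_root)
  have "T (\<pi> (root_elt 5 r) v) (mat 1, 0) = T v (mat 1, 0)" for r v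
    using hom_levi[OF T x_b_levi(1), of r v "mat 1" 0] hom_borel[OF T, of 1 v r 0] chi
    by (simp add: x_b_levi omega_root[unfolded root_elt_pos] root_elt_pos psi_0 multiplicative_character_def)
  then show "eqv (eval_one T) i (\<lambda>r. 1)" if "i \<in> {1, 3, 4, 5}" for i
    using that by (auto simp: eqv_def eval_one_def hom_radical[OF T] omega_root psi_0)
qed

text \<open>The point \<xi> = 0 is fixed by the scaling in the Weil representation, so only its
  quadratic character remains; the factor \<open>chi c\<close> comes from
  \<open>I_chi\<close>.\<close>

lemma eval_one_torus:
  assumes T: "T \<in> homs" and c: "c \<noteq> 0"
  shows "eval_one T (\<pi> (h_torus c (inverse c)) v) = quadratic_character c * chi c * eval_one T v"
  using hom_levi[OF T h_torus_levi(1)[OF c], of v "mat 1" 0] hom_borel[OF T c, of v 0 0]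
  by (simp add: h_torus_levi(2)[OF c] omega_torus[OF c] eval_one_def)

lemma torus_scalar_nonzero:
  assumes "c \<noteq> 0"
  shows "quadratic_character c * chi c \<noteq> 0"
proof -
  have "chi c * chi (inverse c) = 1"
    using chi assms unfolding multiplicative_character_def by (metis nonzero_imp_inverse_nonzero right_inverse)
  then have "chi c \<noteq> 0" by auto
  then show ?thesis using assms by (simp add: quadratic_character_def)
qed

text \<open>U_\<alpha> translates \<xi>, so evaluation at (1, 0) determines all values at (1,
  \<xi>). Passing from 1 to m in SL_2 introduces the operator \<open>\<omega> (levi m)\<close>,
  which is invertible; outside SL_2 both sides vanish.\<close>

lemma hom_eq_scale:
  assumes T: "T \<in> homs" and T': "T' \<in> homs" and eq: "\<And>v. eval_one T v = c * eval_one T' v"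
  shows "T = pointwise (pointwise (*)) c T'"
proof -
  have one: "T v (mat 1, \<xi>) = c * T' v (mat 1, \<xi>)" for v \<xi>
    using eq[of "\<pi> (root_elt 0 \<xi>) v"]
    by (simp add: eval_one_def hom_radical[OF T] hom_radical[OF T'] omega_root)
  have "T v (m, \<xi>) = c * T' v (m, \<xi>)" for v m \<xi>
  proof (cases "m \<in> SL2")
    case False
    then show ?thesis using hom_I_chi[OF T, of v \<xi>] hom_I_chi[OF T', of v \<xi>] by (simp add: I_chi_def)
  next
    case True
    note inv = inverse_SL2[OF True]
    let ?n = "matrix_inv m"
    have n: "?n \<in> SL2" "levi ?n ** levi m = mat 1"
      using inv levi_mult[of ?n m] True by (simp_all add: levi_one)
    have rep: "is_representation (pointwise (*)) J_grp \<omega>" using weil by (simp add: weil_representation_def)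
    note rep' = conjunct2[OF rep[unfolded is_representation_def]]
    note lin = conjunct1[OF rep'] and one' = conjunct1[OF conjunct2[OF rep']]
      and mult = conjunct2[OF conjunct2[OF rep']]
    have inverse: "\<omega> (levi ?n) (\<omega> (levi m) \<phi>) = \<phi>" for \<phi>
      using mult[rule_format, OF J_levi(1)[OF n(1)] J_levi(1)[OF True]]
      by (simp add: n(2) one' fun_eq_iff)
    interpret L: Vector_Spaces.linear "pointwise (*)" "pointwise (*)" "\<omega> (levi m)"
      by (rule lin[rule_format, OF J_levi(1)[OF True]])
    have "\<omega> (levi m) (\<lambda>y. T v (m, y)) = pointwise (*) c (\<omega> (levi m) (\<lambda>y. T' v (m, y)))"
      using one[of "\<pi> (levi m) v"]
      by (simp add: hom_levi[OF T True] hom_levi[OF T' True] pointwise_def fun_eq_iff)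
    also have "\<dots> = \<omega> (levi m) (pointwise (*) c (\<lambda>y. T' v (m, y)))" by (simp add: L.scale)
    finally have "(\<lambda>y. T v (m, y)) = pointwise (*) c (\<lambda>y. T' v (m, y))" using inverse by metis
    then show ?thesis by (simp add: pointwise_def fun_eq_iff)
  qed
  then show ?thesis by (simp add: fun_eq_iff pointwise_def)
qed

definition whittaker_coeff :: "'v \<Rightarrow> ('v \<Rightarrow> ('k^2^2) \<times> 'k \<Rightarrow> complex) \<Rightarrow> complex" where
  "whittaker_coeff w T = fourier 1 (exch (conj_fun (eval_one T))) w"

text \<open>The combination of the two functionals is chosen so that its Whittaker coefficient
  cancels. It keeps a torus eigenvalue because that eigenvalue is the same for T and T'.\<close>

lemma homs_dependent:
  assumes T: "T \<in> homs" and T': "T' \<in> homs" and w: "\<And>v. \<exists>c. whit v = s c w"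
  shows "whittaker_coeff w T' * eval_one T v = whittaker_coeff w T * eval_one T' v"
proof -
  define f where "f v = whittaker_coeff w T' * eval_one T v - whittaker_coeff w T * eval_one T' v" for v
  have "f v = 0"
  proof (rule functional_zero[OF _ _ _ _ w])
    show "functional f"
      unfolding functional_def f_def eval_one_def
      by (simp add: hom_add_scale[OF T] hom_add_scale[OF T'] algebra_simps)
    show "eqv f 2 \<psi>" "\<And>i. i \<in> {1, 3, 4, 5} \<Longrightarrow> eqv f i (\<lambda>r. 1)"
      using eval_one_eqv[OF T] eval_one_eqv[OF T'] unfolding eqv_def f_def
      by (simp_all add: algebra_simps)
    show "\<exists>d. d \<noteq> 0 \<and> (\<forall>v. f (\<pi> (h_torus c (inverse c)) v) = d * f v)" if "c \<noteq> 0" for c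
      using torus_scalar_nonzero[OF that] unfolding f_def
      by (intro exI[of _ "quadratic_character c * chi c"])
        (simp add: eval_one_torus[OF T that] eval_one_torus[OF T' that] algebra_simps)
    have "fourier 1 (exch (conj_fun f)) w =
        whittaker_coeff w T' * whittaker_coeff w T - whittaker_coeff w T * whittaker_coeff w T'"
      unfolding whittaker_coeff_def fourier_def exch_def conj_fun_def f_def
      by (simp add: sum_subtractf sum_distrib_left right_diff_distrib mult.left_commute)
    then show "fourier 1 (exch (conj_fun f)) w = 0" by simp
  qed
  then show ?thesis by (simp add: f_def)
qed

theorem dim_homs_le_one: "vector_space.dim (pointwise (pointwise (*))) homs \<le> 1"
proof -
  interpret hv: vector_space "pointwise (pointwise (*)) :: complex \<Rightarrow> ('v \<Rightarrow> ('k^2^2) \<times> 'k \<Rightarrow> complex) \<Rightarrow> _"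
    by (intro vector_space_pointwise vector_space_mult)
  obtain w where w: "\<And>v. \<exists>c. whit v = s c w" using whittaker_unique by blast
  obtain T' where T': "homs \<subseteq> hv.span {T'}"
  proof (cases "\<exists>T'\<in>homs. whittaker_coeff w T' \<noteq> 0")
    case True
    then obtain T' where *: "T' \<in> homs" "whittaker_coeff w T' \<noteq> 0" by blast
    have "T = pointwise (pointwise (*)) (whittaker_coeff w T / whittaker_coeff w T') T'" if "T \<in> homs" for T
      by (rule hom_eq_scale[OF that *(1)])
        (use homs_dependent[OF that *(1) w] *(2) in \<open>simp add: field_simps\<close>)
    then show thesis using that[of T'] unfolding hv.span_singleton by blast
  next
    case False
    \<comment> \<open>Here every T has vanishing Whittaker coefficient, so \<open>eval_one T\<close>
      is zero; comparing T with itself with factor 0 gives T = 0, and the span of 0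
      suffices.\<close>
    have "T = pointwise (pointwise (*)) 0 T" if T: "T \<in> homs" for T
    proof (rule hom_eq_scale[OF T T])
      fix v
      have "eval_one T v = 0"
      proof (rule functional_zero[OF _ eval_one_eqv[OF T] _ w])
        show "functional (eval_one T)"
          by (simp add: functional_def eval_one_def hom_add_scale[OF T])
        show "\<exists>d. d \<noteq> 0 \<and> (\<forall>v. eval_one T (\<pi> (h_torus c (inverse c)) v) = d * eval_one T v)" if "c \<noteq> 0" for c
          using eval_one_torus[OF T that] torus_scalar_nonzero[OF that] by blast
        show "fourier 1 (exch (conj_fun (eval_one T))) w = 0"
          using False T unfolding whittaker_coeff_def by blast
      qed
      then show "eval_one T v = 0 * eval_one T v" by simp
    qed
    then have "T = 0" if "T \<in> homs" for T using that hv.scale_zero_left by metis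
    then show thesis using that[of 0] by (metis hv.span_zero subsetI)
  qed
  have "hv.dim homs \<le> card {T'}" by (rule hv.dim_le_card[OF T']) simp
  then show ?thesis by simp
qed

end

theorem theorem1p4:
  fixes \<psi> chi :: "'k::{field,finite} \<Rightarrow> complex"
    and s :: "complex \<Rightarrow> 'v::ab_group_add \<Rightarrow> 'v"
    and \<pi> :: "'k^7^7 \<Rightarrow> 'v \<Rightarrow> 'v"
    and \<omega> :: "'k^7^7 \<Rightarrow> ('k \<Rightarrow> complex) \<Rightarrow> ('k \<Rightarrow> complex)"
  assumes "odd CHAR('k)"
    and "nontrivial_additive_character \<psi>"
    and "weil_representation \<psi> \<omega>"
    and "irreducible_rep s G2 \<pi>"
    and "cuspidal_G2 \<pi>"
    and "multiplicative_character chi"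
  shows "vector_space.dim (pointwise (pointwise (*)))
           (Hom_rep J_grp s \<pi> (pointwise (*)) (I_tensor_weil_space chi) (I_tensor_weil_action \<omega>)) \<le> 1"
proof -
  interpret fourier_jacobi s \<pi> \<psi> \<omega> chi
    by unfold_locales (fact assms)+
  show ?thesis by (rule dim_homs_le_one)
qed

end
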